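(* Let $k \geq 1$ be an integer. For any $\delta > 0$ there is some $N_0 \geq 1$ such that whenever $N \geq N_0$ and $A \subseteq [k]^N$ satisfies $|A| \geq \delta k^N$, the set $A$ contains a combinatorial line: that is, there are a nonempty subset $I \subseteq [N]$ and some $w_0 \in [k]^{[N]\setminus I}$ such that \[A \supseteq \{w \in [k]^N:\ w|_{[N]\setminus I} = w_0,\ w|_I \text{ is constant}\}.\]
   Context: For a positive integer $n$, $[n] := \{1,2,\ldots,n\}$. An element $w \in [k]^N$ is regarded as a function $[N] \to [k]$ (a word of length $N$ over the alphabet $[k]$), and $w|_I$ denotes its restriction to $I \subseteq [N]$. *)

theory Defs
  imports Complex_Main "HOL-Library.FuncSet"
begin

definition words :: "nat \<Rightarrow> nat set \<Rightarrow> (nat \<Rightarrow> nat) set" where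
  "words k J = J \<rightarrow>\<^sub>E {1..k}"

definition combinatorial_line ::
    "nat \<Rightarrow> nat \<Rightarrow> nat set \<Rightarrow> (nat \<Rightarrow> nat) \<Rightarrow> (nat \<Rightarrow> nat) set" where
  "combinatorial_line k N I w0 =
     {w \<in> words k {1..N}. restrict w ({1..N} - I) = w0 \<and> (\<exists>c. \<forall>i\<in>I. w i = c)}"

definition contains_combinatorial_line ::
    "nat \<Rightarrow> nat \<Rightarrow> (nat \<Rightarrow> nat) set \<Rightarrow> bool" where
  "contains_combinatorial_line k N A \<longleftrightarrow>
     (\<exists>I w0. I \<noteq> {} \<and> I \<subseteq> {1..N} \<and> w0 \<in> words k ({1..N} - I) \<and>
             combinatorial_line k N I w0 \<subseteq> A)"

end

theory Submission
  imports Defs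
begin

text \<open>
  The theorem is proved by induction on the alphabet. Suppose that the density theorem is known
  for an alphabet \<open>K\<close>, hence also for subspaces of any dimension in place of lines
  (\<open>density_forces_subspaces\<close>), and let \<open>Q\<close> be \<open>K\<close> with one more letter \<open>z\<close>. The argument is a
  density increment in the style of Polymath and of Dodos, Kanellopoulos and Tyros, but it is run
  at the critical density, so that a single increment is already a contradiction, and it uses only
  the uniform measure.

  Assume that the theorem fails for \<open>Q\<close> and let \<open>d > 0\<close> be the infimum of the densities that force
  a line. Then in high dimension no line-free set is much denser than \<open>d\<close>, whereas some line-free
  set \<open>A\<close> is almost as dense as \<open>d\<close>. Fix a set \<open>P\<close> of boundedly many coordinates. The fibres of \<open>A\<close>
  over the words on \<open>P\<close> are line-free, so none of them is much denser than \<open>d\<close>; as they have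
  density almost \<open>d\<close> on average and there are boundedly many of them, all of them have density
  almost \<open>d\<close>.

  Since these fibres are all dense, the theorem for \<open>K\<close> yields many lines whose points with a letter
  of \<open>K\<close> at the wildcards lie in \<open>A\<close>. As \<open>A\<close> is line-free, the remaining point of such a line, with
  \<open>z\<close> at the wildcards, is outside \<open>A\<close>. The point with letter \<open>a \<in> K\<close> arises
  from that with \<open>z\<close> by replacing letters \<open>z\<close> by \<open>a\<close>; that it lies in \<open>A\<close> is therefore a property of
  the point with \<open>z\<close> that is not affected by exchanging \<open>a\<close> and \<open>z\<close> at some of its coordinates: the
  property is \<open>(a,z)\<close>-insensitive. So on some large subspace there are insensitive sets \<open>D a\<close>, one for each
  \<open>a \<in> K\<close>, whose intersection \<open>D\<close> is disjoint from \<open>A\<close> and not too small, its density being bounded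
  below by some \<open>\<theta>\<close> that depends on \<open>d\<close> and \<open>K\<close> alone (\<open>correlation\<close>). What makes \<open>\<theta>\<close> independent of
  the dimension of that subspace is a sampling principle: a dense set of words stays dense if a
  bounded number of well chosen coordinates is restricted to a smaller alphabet
  (\<open>sample_coordinates\<close>).

  So \<open>A\<close> has relative density noticeably above \<open>d\<close> on the complement of \<open>D\<close>. This is impossible,
  because up to a small error that complement decomposes into subspaces of large dimension, on each
  of which \<open>A\<close> is at most slightly denser than \<open>d\<close>. The decomposition comes again from the theorem
  for \<open>K\<close>: a subspace of words over \<open>K\<close> that lies in an \<open>(a,z)\<close>-insensitive set extends to a
  subspace over \<open>Q\<close> that lies in it, and such subspaces can be removed until little is left
  (\<open>insensitive_set_small\<close>); intersections of insensitive sets and their complements are treated by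
  iterating this. In place of decompositions the formal statements bound averages: a function
  \<open>f \<le> 1\<close> with average at most 0 on every subspace of dimension \<open>m\<close> has average at most \<open>\<beta>\<close> on such
  sets, if the dimension is large.
\<close>

section \<open>Uniform averages\<close>

definition avg :: "'a set \<Rightarrow> ('a \<Rightarrow> real) \<Rightarrow> real" where
  "avg X f = (\<Sum>x\<in>X. f x) / real (card X)"

lemma avg_mono: "(\<And>x. x \<in> X \<Longrightarrow> f x \<le> g x) \<Longrightarrow> avg X f \<le> avg X g"
  unfolding avg_def by (intro divide_right_mono sum_mono) auto

lemma avg_cong: "(\<And>x. x \<in> X \<Longrightarrow> f x = g x) \<Longrightarrow> avg X f = avg X g"
  unfolding avg_def by (metis sum.cong)

lemma avg_const: "finite X \<Longrightarrow> X \<noteq> {} \<Longrightarrow> avg X (\<lambda>_. c) = c"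
  unfolding avg_def by simp

lemma avg_add: "avg X (\<lambda>x. f x + g x) = avg X f + avg X g"
  unfolding avg_def by (simp add: sum.distrib add_divide_distrib)

lemma avg_diff: "avg X (\<lambda>x. f x - g x) = avg X f - avg X g"
  unfolding avg_def by (simp add: sum_subtractf diff_divide_distrib)

lemma avg_cmult: "avg X (\<lambda>x. c * f x) = c * avg X f"
  unfolding avg_def by (simp add: sum_distrib_left)

lemma avg_multc: "avg X (\<lambda>x. f x * c) = avg X f * c"
  unfolding avg_def by (simp add: sum_distrib_right)

lemma avg_sum: "avg X (\<lambda>x. \<Sum>c\<in>C. f c x) = (\<Sum>c\<in>C. avg X (f c))"
  unfolding avg_def by (simp add: sum_divide_distrib sum.swap[of _ C X])

lemma avg_nonneg: "(\<And>x. x \<in> X \<Longrightarrow> 0 \<le> f x) \<Longrightarrow> 0 \<le> avg X f"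
  unfolding avg_def by (intro divide_nonneg_nonneg sum_nonneg) auto

lemma avg_le:
  assumes "finite X" "X \<noteq> {}" "\<And>x. x \<in> X \<Longrightarrow> f x \<le> c"
  shows "avg X f \<le> c"
  using avg_mono[of X f "\<lambda>_. c"] avg_const[of X c] assms by simp

lemma avg_ge:
  assumes "finite X" "X \<noteq> {}" "\<And>x. x \<in> X \<Longrightarrow> c \<le> f x"
  shows "c \<le> avg X f"
  using avg_mono[of X "\<lambda>_. c" f] avg_const[of X c] assms by simp

lemma avg_ge_witness:
  assumes "finite X" "X \<noteq> {}" "c \<le> avg X f"
  obtains x where "x \<in> X" "c \<le> f x"
proof (rule ccontr)
  assume "\<not> thesis"
  then have "\<And>x. x \<in> X \<Longrightarrow> f x < c" using that by force
  then have "(\<Sum>x\<in>X. f x) < (\<Sum>x\<in>X. c)"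
    by (intro sum_strict_mono assms)
  then have "avg X f < c"
    using assms by (simp add: avg_def field_simps card_gt_0_iff)
  then show False using assms by simp
qed

lemma avg_swap: "avg X (\<lambda>x. avg Y (\<lambda>y. f x y)) = avg Y (\<lambda>y. avg X (\<lambda>x. f x y))"
  unfolding avg_def by (simp add: sum_divide_distrib[symmetric] sum.swap[of _ Y X] mult.commute)

lemma avg_bij: "bij_betw h X Y \<Longrightarrow> avg Y f = avg X (\<lambda>x. f (h x))"
  unfolding avg_def by (simp add: sum.reindex_bij_betw bij_betw_same_card)

lemma avg_Times: "avg (X \<times> Y) f = avg X (\<lambda>x. avg Y (\<lambda>y. f (x, y)))"
  unfolding avg_def
  by (simp add: sum_divide_distrib[symmetric] sum.cartesian_product mult.commute
      card_cartesian_product)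

lemma avg_square_le:
  assumes "finite X" "X \<noteq> {}"
  shows "(avg X f)\<^sup>2 \<le> avg X (\<lambda>x. (f x)\<^sup>2)"
proof -
  have "0 \<le> avg X (\<lambda>x. (f x - avg X f)\<^sup>2)" by (rule avg_nonneg) simp
  also have "\<dots> = avg X (\<lambda>x. (f x)\<^sup>2 - 2 * avg X f * f x + (avg X f)\<^sup>2)"
    by (rule avg_cong) (simp add: power2_eq_square algebra_simps)
  also have "\<dots> = avg X (\<lambda>x. (f x)\<^sup>2) - (avg X f)\<^sup>2"
    using assms by (simp add: avg_add avg_diff avg_cmult avg_const power2_eq_square)
  finally show ?thesis by simp
qed

lemma avg_on_image:
  assumes "finite X" "inj_on h P" "h ` P \<subseteq> X"
  shows "avg X (\<lambda>e. g e * of_bool (e \<in> h ` P)) = real (card P) / real (card X) * avg P (\<lambda>x. g (h x))"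
proof (cases "P = {}")
  case False
  have "finite P" using assms finite_subset finite_imageD by metis
  then have "0 < card P" using False by (simp add: card_gt_0_iff)
  have "(\<Sum>e\<in>X. g e * of_bool (e \<in> h ` P)) = (\<Sum>e\<in>h ` P. g e)"
    using assms by (intro sum.mono_neutral_cong_right) auto
  also have "\<dots> = (\<Sum>x\<in>P. g (h x))" using assms by (simp add: sum.reindex)
  finally show ?thesis using \<open>0 < card P\<close> by (simp add: avg_def)
qed (simp add: avg_def)

text \<open>A function whose average is close to an upper bound is close to that bound everywhere, if its
  domain is small.\<close>

lemma avg_le_deficit:
  assumes "finite X" "x0 \<in> X" "\<And>x. x \<in> X \<Longrightarrow> h x \<le> u"
  shows "avg X h \<le> u - (u - h x0) / real (card X)"
proof -
  have X: "0 < card X" using assms by (auto simp: card_gt_0_iff)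
  have "u - h x0 \<le> (\<Sum>x\<in>X. u - h x)"
    using assms member_le_sum[of x0 X "\<lambda>x. u - h x"] by simp
  also have "\<dots> = real (card X) * u - (\<Sum>x\<in>X. h x)" by (simp add: sum_subtractf)
  finally show ?thesis using X by (simp add: avg_def field_simps)
qed

text \<open>Markov's inequality makes half of the density survive on a positive proportion of the
  fibres. Each such fibre contains one of boundedly many configurations, so some configuration
  is contained in many fibres at once.\<close>

lemma common_configuration:
  fixes R :: "'x \<Rightarrow> 'y \<Rightarrow> bool" and G :: "'c \<Rightarrow> 'x set"
  assumes X: "finite X" "X \<noteq> {}" and Y: "finite Y" "Y \<noteq> {}"
    and C: "finite C" "real (card C) \<le> b" and "\<delta> > 0"
    and dense: "\<delta> \<le> avg Y (\<lambda>y. avg X (\<lambda>x. of_bool (R x y)))"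
    and conf: "\<And>A. A \<subseteq> X \<Longrightarrow> \<delta> / 2 \<le> avg X (\<lambda>x. of_bool (x \<in> A)) \<Longrightarrow> \<exists>c\<in>C. G c \<subseteq> A"
  obtains c where "c \<in> C" "\<delta> / (2 * b) \<le> avg Y (\<lambda>y. of_bool (\<forall>x\<in>G c. R x y))"
proof -
  define h where "h y = avg X (\<lambda>x. of_bool (R x y))" for y
  define g where "g c = avg Y (\<lambda>y. of_bool (\<forall>x\<in>G c. R x y))" for c
  have h1: "h y \<le> 1" for y unfolding h_def by (rule avg_le) (use X in auto)
  have "h y \<le> \<delta> / 2 + (\<Sum>c\<in>C. of_bool (\<forall>x\<in>G c. R x y))" for y
  proof (cases "\<delta> / 2 \<le> h y")
    case True
    have "\<delta> / 2 \<le> avg X (\<lambda>x. of_bool (x \<in> {x \<in> X. R x y}))"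
      using True unfolding h_def by (simp add: avg_def)
    from conf[OF _ this] obtain c where c: "c \<in> C" "G c \<subseteq> {x \<in> X. R x y}" by auto
    then have "1 \<le> (\<Sum>c\<in>C. of_bool (\<forall>x\<in>G c. R x y) :: real)"
      using C member_le_sum[of c C "\<lambda>c. of_bool (\<forall>x\<in>G c. R x y) :: real"]
      by (simp add: subset_iff del: sum_of_bool_eq)
    then show ?thesis using h1[of y] \<open>\<delta> > 0\<close> by linarith
  next
    case False
    moreover have "0 \<le> (\<Sum>c\<in>C. of_bool (\<forall>x\<in>G c. R x y) :: real)" by (rule sum_nonneg) simp
    ultimately show ?thesis by linarith
  qed
  then have "avg Y h \<le> avg Y (\<lambda>y. \<delta> / 2 + (\<Sum>c\<in>C. of_bool (\<forall>x\<in>G c. R x y)))"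
    by (intro avg_mono)
  also have "\<dots> = \<delta> / 2 + (\<Sum>c\<in>C. g c)"
    using Y by (simp add: avg_add avg_const avg_sum g_def)
  finally have sum: "\<delta> / 2 \<le> (\<Sum>c\<in>C. g c)" using dense unfolding h_def by linarith
  have "C \<noteq> {}" using sum \<open>\<delta> > 0\<close> by auto
  then have b: "0 < real (card C)" using C by (simp add: card_gt_0_iff)
  have "\<delta> / (2 * b) \<le> (\<delta> / 2) / real (card C)"
    using b C \<open>\<delta> > 0\<close> by (simp add: frac_le)
  also have "\<dots> \<le> avg C g" unfolding avg_def by (rule divide_right_mono[OF sum]) simp
  finally obtain c where "c \<in> C" "\<delta> / (2 * b) \<le> g c"
    using avg_ge_witness C \<open>C \<noteq> {}\<close> by blast
  then show ?thesis using that unfolding g_def by blast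
qed

section \<open>Words and gluing\<close>

definition glue :: "nat set \<Rightarrow> (nat \<Rightarrow> 'a) \<Rightarrow> (nat \<Rightarrow> 'a) \<Rightarrow> nat \<Rightarrow> 'a" where
  "glue I x y = (\<lambda>i. if i \<in> I then x i else y i)"

lemma glue_in: "x \<in> I \<rightarrow>\<^sub>E S \<Longrightarrow> y \<in> J \<rightarrow>\<^sub>E S \<Longrightarrow> glue I x y \<in> (I \<union> J) \<rightarrow>\<^sub>E S"
  by (auto simp: glue_def PiE_iff extensional_def)

lemma words_finite: "finite (J::nat set) \<Longrightarrow> finite S \<Longrightarrow> finite (J \<rightarrow>\<^sub>E S)"
  by (simp add: finite_PiE)

lemma words_nonempty: "S \<noteq> {} \<Longrightarrow> (J::nat set) \<rightarrow>\<^sub>E S \<noteq> {}"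
  by (simp add: PiE_eq_empty_iff)

lemma constant_word_in: "a \<in> S \<Longrightarrow> (\<lambda>i\<in>J. a) \<in> J \<rightarrow>\<^sub>E S"
  unfolding restrict_PiE_iff by blast

lemma glue_commute:
  assumes "x \<in> I \<rightarrow>\<^sub>E S" "y \<in> J \<rightarrow>\<^sub>E S" "I \<inter> J = {}"
  shows "glue I x y = glue J y x"
proof
  fix j
  show "glue I x y j = glue J y x j"
    using assms(3) PiE_arb[OF assms(1), of j] PiE_arb[OF assms(2), of j] by (auto simp: glue_def)
qed

lemma bij_betw_glue:
  fixes I J :: "nat set" and S :: "'a set"
  assumes "I \<inter> J = {}"
  shows "bij_betw (\<lambda>(x, y). glue I x y) ((I \<rightarrow>\<^sub>E S) \<times> (J \<rightarrow>\<^sub>E S)) ((I \<union> J) \<rightarrow>\<^sub>E S)"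
  by (rule bij_betw_byWitness[where f' = "\<lambda>w. (restrict w I, restrict w J)"])
    (use assms in \<open>auto simp: glue_def PiE_iff extensional_def fun_eq_iff\<close>)

lemma avg_glue:
  fixes I J :: "nat set" and S :: "'a set"
  assumes "I \<inter> J = {}"
  shows "avg ((I \<union> J) \<rightarrow>\<^sub>E S) f = avg (I \<rightarrow>\<^sub>E S) (\<lambda>x. avg (J \<rightarrow>\<^sub>E S) (\<lambda>y. f (glue I x y)))"
  by (simp add: avg_bij[OF bij_betw_glue[OF assms]] avg_Times)

lemma avg_singleton_words: "avg ({i} \<rightarrow>\<^sub>E S) f = avg S (\<lambda>s. f (\<lambda>j\<in>{i}. s))"
proof (rule avg_bij)
  show "bij_betw (\<lambda>s. \<lambda>j\<in>{i}. s) S ({i} \<rightarrow>\<^sub>E S)"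
    by (rule bij_betw_byWitness[where f' = "\<lambda>w. w i"])
      (auto simp: PiE_iff extensional_def fun_eq_iff split: if_splits)
qed

lemma bij_betw_map_words:
  assumes "inj_on r S"
  shows "bij_betw (\<lambda>v. \<lambda>i\<in>I. r (v i)) (I \<rightarrow>\<^sub>E S) (I \<rightarrow>\<^sub>E r ` S)"
proof (rule bij_betw_byWitness[where f' = "\<lambda>e. \<lambda>i\<in>I. inv_into S r (e i)"])
  show "\<forall>v\<in>I \<rightarrow>\<^sub>E S. (\<lambda>i\<in>I. inv_into S r ((\<lambda>i\<in>I. r (v i)) i)) = v"
  proof (intro ballI ext)
    fix v i assume v: "v \<in> I \<rightarrow>\<^sub>E S"
    show "(\<lambda>i\<in>I. inv_into S r ((\<lambda>i\<in>I. r (v i)) i)) i = v i"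
      using PiE_arb[OF v, of i] PiE_mem[OF v, of i] assms by (cases "i \<in> I") simp_all
  qed
  show "\<forall>e\<in>I \<rightarrow>\<^sub>E r ` S. (\<lambda>i\<in>I. r ((\<lambda>i\<in>I. inv_into S r (e i)) i)) = e"
  proof (intro ballI ext)
    fix e i assume e: "e \<in> I \<rightarrow>\<^sub>E r ` S"
    show "(\<lambda>i\<in>I. r ((\<lambda>i\<in>I. inv_into S r (e i)) i)) i = e i"
      using PiE_arb[OF e, of i] PiE_mem[OF e, of i] by (cases "i \<in> I") (simp_all add: f_inv_into_f)
  qed
  show "(\<lambda>v. \<lambda>i\<in>I. r (v i)) ` (I \<rightarrow>\<^sub>E S) \<subseteq> I \<rightarrow>\<^sub>E r ` S"
  proof (rule image_subsetI, rule PiE_I)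
    fix v i assume v: "v \<in> I \<rightarrow>\<^sub>E S" and i: "i \<in> I"
    show "(\<lambda>i\<in>I. r (v i)) i \<in> r ` S" using PiE_mem[OF v i] i by simp
  qed simp
  show "(\<lambda>e. \<lambda>i\<in>I. inv_into S r (e i)) ` (I \<rightarrow>\<^sub>E r ` S) \<subseteq> I \<rightarrow>\<^sub>E S"
  proof (rule image_subsetI, rule PiE_I)
    fix e i assume e: "e \<in> I \<rightarrow>\<^sub>E r ` S" and i: "i \<in> I"
    show "(\<lambda>i\<in>I. inv_into S r (e i)) i \<in> S" using inv_into_into[OF PiE_mem[OF e i]] i by simp
  qed simp
qed

section \<open>Sampling coordinates\<close>

text \<open>The cross terms vanish because distinct coordinates are independent and \<open>h\<close> has mean zero.\<close>

lemma avg_square_sum_letters: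
  fixes J :: "nat set" and h :: "'a \<Rightarrow> real"
  assumes T: "finite T" "T \<noteq> {}" and J: "finite J" and mean: "avg T h = 0"
  shows "avg (J \<rightarrow>\<^sub>E T) (\<lambda>t. (\<Sum>j\<in>J. h (t j))\<^sup>2) = real (card J) * avg T (\<lambda>s. (h s)\<^sup>2)"
  using J
proof (induction J rule: finite_induct)
  case empty
  show ?case by (simp add: avg_def)
next
  case (insert i J)
  let ?Y = "\<lambda>t. \<Sum>j\<in>J. h (t j)"
  have eq: "(\<Sum>j\<in>insert i J. h (glue J t (\<lambda>j\<in>{i}. s) j)) = ?Y t + h s" for t s
  proof -
    have "(\<Sum>j\<in>J. h (glue J t (\<lambda>j\<in>{i}. s) j)) = ?Y t"
      by (rule sum.cong) (auto simp: glue_def)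
    then show ?thesis using insert by (simp add: glue_def)
  qed
  have "avg (insert i J \<rightarrow>\<^sub>E T) (\<lambda>t. (\<Sum>j\<in>insert i J. h (t j))\<^sup>2)
      = avg (J \<rightarrow>\<^sub>E T) (\<lambda>t. avg T (\<lambda>s. (?Y t + h s)\<^sup>2))"
    using avg_glue[of J "{i}" T] insert
    by (simp add: avg_singleton_words eq Un_commute del: sum.insert)
  also have "\<dots> = avg (J \<rightarrow>\<^sub>E T) (\<lambda>t. (?Y t)\<^sup>2 + avg T (\<lambda>s. (h s)\<^sup>2))"
    using T mean by (intro avg_cong) (simp add: power2_sum avg_add avg_const avg_cmult)
  also have "\<dots> = real (card J) * avg T (\<lambda>s. (h s)\<^sup>2) + avg T (\<lambda>s. (h s)\<^sup>2)"
    using insert T by (simp add: avg_add avg_const words_finite words_nonempty)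
  finally show ?case using insert by (simp add: algebra_simps)
qed

text \<open>Forcing the letter at position \<open>i\<close> into \<open>S\<close> reweights the uniform measure by the factor
  \<open>(|T| / |S|) * [t i \<in> S]\<close>. Averaged over \<open>i\<close>, this factor is close to 1 in mean square by the
  law of large numbers, so for some \<open>i\<close> the average of \<open>f\<close> hardly drops.\<close>

lemma sample_one_coordinate:
  fixes T S :: "'a set" and J :: "nat set"
  assumes T: "finite T" "S \<subseteq> T" "S \<noteq> {}" and "\<epsilon> > 0"
    and J: "finite J" "J \<noteq> {}" "real (card T) \<le> \<epsilon>\<^sup>2 * real (card J)"
    and f: "\<And>t. t \<in> J \<rightarrow>\<^sub>E T \<Longrightarrow> 0 \<le> f t \<and> f t \<le> 1"
  obtains i where "i \<in> J"
    "avg (J \<rightarrow>\<^sub>E T) f - \<epsilon> \<le> avg ((J - {i}) \<rightarrow>\<^sub>E T) (\<lambda>t. avg ({i} \<rightarrow>\<^sub>E S) (\<lambda>e. f (glue (J - {i}) t e)))"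
proof -
  let ?W = "J \<rightarrow>\<^sub>E T"
  have S: "finite S" using T finite_subset by blast
  have cards: "0 < card S" "card S \<le> card T" "0 < card T"
    using T S by (auto simp: card_gt_0_iff card_mono)
  have T0: "T \<noteq> {}" using T by auto
  have W: "finite ?W" "?W \<noteq> {}" using T J T0 by (auto simp: words_finite words_nonempty)
  define c where "c = real (card T) / real (card S)"
  have c1: "1 \<le> c" using cards by (simp add: c_def)
  \<comment> \<open>\<open>1 + h s\<close> is the density of the uniform measure on \<open>S\<close> relative to that on \<open>T\<close>.\<close>
  define h where "h s = c * of_bool (s \<in> S) - 1" for s
  have ind: "avg T (\<lambda>s. of_bool (s \<in> S) * p s) = avg S p / c" for p
  proof -
    have "(\<Sum>s\<in>T. of_bool (s \<in> S) * p s) = sum p S"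
      using T by (intro sum.mono_neutral_cong_right) auto
    then show ?thesis using cards by (simp add: avg_def c_def)
  qed
  have ind1: "avg T (\<lambda>s. of_bool (s \<in> S)) = 1 / c"
    using ind[of "\<lambda>_. 1"] S T by (simp add: avg_const)
  have mean: "avg T h = 0"
    using T T0 c1 by (simp add: h_def[abs_def] avg_diff avg_const avg_cmult ind1)
  have sq: "(h s)\<^sup>2 = (c\<^sup>2 - 2 * c) * of_bool (s \<in> S) + 1" for s
    by (simp add: h_def power2_eq_square algebra_simps)
  have "avg T (\<lambda>s. (h s)\<^sup>2) = (c\<^sup>2 - 2 * c) * (1 / c) + 1"
    unfolding sq using T T0 by (simp add: avg_add avg_const avg_cmult ind1)
  also have "\<dots> = c - 1" using c1 by (simp add: power2_eq_square field_simps)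
  finally have var: "avg T (\<lambda>s. (h s)\<^sup>2) = c - 1" .
  define r where "r i = avg ((J - {i}) \<rightarrow>\<^sub>E T) (\<lambda>t. avg ({i} \<rightarrow>\<^sub>E S) (\<lambda>e. f (glue (J - {i}) t e)))" for i
  have shift: "r i - avg ?W f = avg ?W (\<lambda>t. f t * h (t i))" if "i \<in> J" for i
  proof -
    have eq: "(J - {i}) \<union> {i} = J" using that by auto
    have split: "avg ?W g = avg ((J - {i}) \<rightarrow>\<^sub>E T) (\<lambda>t. avg ({i} \<rightarrow>\<^sub>E T) (\<lambda>e. g (glue (J - {i}) t e)))" for g
      using avg_glue[of "J - {i}" "{i}" T g] unfolding eq by simp
    have "avg ?W (\<lambda>t. of_bool (t i \<in> S) * f t) = r i / c"
    proof -
      have "avg ({i} \<rightarrow>\<^sub>E T) (\<lambda>e. of_bool (glue (J - {i}) t e i \<in> S) * f (glue (J - {i}) t e))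
          = avg ({i} \<rightarrow>\<^sub>E S) (\<lambda>e. f (glue (J - {i}) t e)) * (1 / c)" for t
        using ind[of "\<lambda>s. f (glue (J - {i}) t (\<lambda>j\<in>{i}. s))"]
        unfolding avg_singleton_words by (simp add: glue_def)
      then show ?thesis unfolding split r_def by (simp only: avg_multc) simp
    qed
    moreover have "avg ?W (\<lambda>t. f t * h (t i)) = c * avg ?W (\<lambda>t. of_bool (t i \<in> S) * f t) - avg ?W f"
      unfolding avg_cmult[symmetric] avg_diff[symmetric]
      by (rule avg_cong) (simp add: h_def algebra_simps)
    ultimately show ?thesis using c1 by simp
  qed
  define n where "n = real (card J)"
  have n: "0 < n" using J by (simp add: n_def card_gt_0_iff)
  have "(avg ?W (\<lambda>t. f t * (\<Sum>j\<in>J. h (t j))))\<^sup>2 \<le> avg ?W (\<lambda>t. (f t * (\<Sum>j\<in>J. h (t j)))\<^sup>2)"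
    by (rule avg_square_le[OF W])
  also have "\<dots> \<le> avg ?W (\<lambda>t. (\<Sum>j\<in>J. h (t j))\<^sup>2)"
  proof (rule avg_mono)
    fix t assume "t \<in> ?W"
    then have "(f t)\<^sup>2 \<le> 1" using f[of t] by (simp add: abs_square_le_1)
    then show "(f t * (\<Sum>j\<in>J. h (t j)))\<^sup>2 \<le> (\<Sum>j\<in>J. h (t j))\<^sup>2"
      by (simp add: power_mult_distrib mult_left_le_one_le)
  qed
  also have "\<dots> = n * (c - 1)"
    using avg_square_sum_letters[OF T(1) T0 J(1) mean] by (simp add: var n_def)
  also have "\<dots> \<le> (\<epsilon> * n)\<^sup>2"
  proof -
    have "c \<le> real (card T)" using cards by (simp add: c_def field_simps)
    then have "c - 1 \<le> \<epsilon>\<^sup>2 * n" using J unfolding n_def by linarith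
    then show ?thesis using n by (simp add: power2_eq_square mult.assoc mult_left_mono mult.left_commute)
  qed
  finally have "- (\<epsilon> * n) \<le> avg ?W (\<lambda>t. f t * (\<Sum>j\<in>J. h (t j)))"
    using n \<open>\<epsilon> > 0\<close> by (simp add: power2_le_iff_abs_le abs_le_iff)
  also have "\<dots> = (\<Sum>j\<in>J. r j - avg ?W f)"
    by (simp add: shift sum_distrib_left avg_sum)
  finally have "- \<epsilon> \<le> avg J (\<lambda>j. r j - avg ?W f)"
    using n by (simp add: avg_def n_def field_simps)
  then obtain i where "i \<in> J" "- \<epsilon> \<le> r i - avg ?W f"
    using avg_ge_witness[OF J(1,2)] by blast
  then show ?thesis using that unfolding r_def by force
qed

text \<open>One coordinate is sampled after the other, and after each step \<open>f\<close> is replaced by its average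
  over the letters of \<open>S\<close> at the sampled coordinate. The number \<open>n\<close> depends on \<open>T\<close> only through its size,
  because \<open>T\<close> will contain a set of coordinates that is chosen after \<open>n\<close>.\<close>

lemma sample_coordinates:
  fixes q m :: nat and \<epsilon> :: real
  assumes "\<epsilon> > 0"
  shows "\<exists>n. \<forall>(J::nat set) (T::'a set) S f. finite J \<longrightarrow> n \<le> card J \<longrightarrow> finite T \<longrightarrow> card T \<le> q \<longrightarrow>
    S \<subseteq> T \<longrightarrow> S \<noteq> {} \<longrightarrow> (\<forall>t\<in>J \<rightarrow>\<^sub>E T. 0 \<le> f t \<and> f t \<le> 1) \<longrightarrow>
    (\<exists>I\<subseteq>J. card I = m \<and>
      avg (J \<rightarrow>\<^sub>E T) f - \<epsilon> \<le> avg ((J - I) \<rightarrow>\<^sub>E T) (\<lambda>t. avg (I \<rightarrow>\<^sub>E S) (\<lambda>e. f (glue (J - I) t e))))"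
  using assms
proof (induction m arbitrary: \<epsilon>)
  case 0
  have "avg (J \<rightarrow>\<^sub>E T) f = avg ((J - {}) \<rightarrow>\<^sub>E T) (\<lambda>t. avg ({} \<rightarrow>\<^sub>E S) (\<lambda>e. f (glue (J - {}) t e)))"
    for J :: "nat set" and T S :: "'a set" and f
  proof (simp add: avg_def[of "{\<lambda>x. undefined}"], rule avg_cong)
    fix t assume "t \<in> J \<rightarrow>\<^sub>E T"
    then have "glue J t (\<lambda>x. undefined) = t" by (auto simp: glue_def fun_eq_iff PiE_iff extensional_def)
    then show "f t = f (glue J t (\<lambda>x. undefined))" by simp
  qed
  moreover have "{} \<subseteq> J \<and> card ({}::nat set) = 0" for J :: "nat set" by simp
  ultimately show ?case using 0 by (intro exI[of _ 0] allI impI exI[of _ "{}"]) simp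
next
  case (Suc m)
  then have "\<epsilon> / 2 > 0" by simp
  from Suc.IH[OF this] obtain n where n:
    "\<forall>(J::nat set) (T::'a set) S f. finite J \<longrightarrow> n \<le> card J \<longrightarrow> finite T \<longrightarrow> card T \<le> q \<longrightarrow>
    S \<subseteq> T \<longrightarrow> S \<noteq> {} \<longrightarrow> (\<forall>t\<in>J \<rightarrow>\<^sub>E T. 0 \<le> f t \<and> f t \<le> 1) \<longrightarrow>
    (\<exists>I\<subseteq>J. card I = m \<and>
      avg (J \<rightarrow>\<^sub>E T) f - \<epsilon> / 2 \<le> avg ((J - I) \<rightarrow>\<^sub>E T) (\<lambda>t. avg (I \<rightarrow>\<^sub>E S) (\<lambda>e. f (glue (J - I) t e))))" ..
  obtain n' :: nat where n': "real q / (\<epsilon> / 2)\<^sup>2 \<le> real n'" using real_arch_simple by blast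
  show ?case
  proof (intro exI[of _ "Suc n + n'"] allI impI)
    fix J :: "nat set" and T S :: "'a set" and f :: "(nat \<Rightarrow> 'a) \<Rightarrow> real"
    assume J: "finite J" "Suc n + n' \<le> card J" and T: "finite T" "card T \<le> q" and S: "S \<subseteq> T" "S \<noteq> {}"
      and f: "\<forall>t\<in>J \<rightarrow>\<^sub>E T. 0 \<le> f t \<and> f t \<le> 1"
    have finS: "finite S" using S T finite_subset by blast
    have "real (card T) \<le> (\<epsilon> / 2)\<^sup>2 * real n'"
      using n' T Suc.prems by (simp add: field_simps)
    also have "\<dots> \<le> (\<epsilon> / 2)\<^sup>2 * real (card J)" using J by (intro mult_left_mono) auto
    finally have large: "real (card T) \<le> (\<epsilon> / 2)\<^sup>2 * real (card J)" .
    have "J \<noteq> {}" "\<epsilon> / 2 > 0" using J Suc.prems by auto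
    then obtain i where i: "i \<in> J"
      "avg (J \<rightarrow>\<^sub>E T) f - \<epsilon> / 2 \<le> avg ((J - {i}) \<rightarrow>\<^sub>E T) (\<lambda>t. avg ({i} \<rightarrow>\<^sub>E S) (\<lambda>e. f (glue (J - {i}) t e)))"
      using sample_one_coordinate[OF T(1) S _ J(1) _ large, of f] f by blast
    define g where "g t = avg ({i} \<rightarrow>\<^sub>E S) (\<lambda>e. f (glue (J - {i}) t e))" for t
    have "0 \<le> g t \<and> g t \<le> 1" if t: "t \<in> (J - {i}) \<rightarrow>\<^sub>E T" for t
    proof -
      have "glue (J - {i}) t e \<in> J \<rightarrow>\<^sub>E T" if "e \<in> {i} \<rightarrow>\<^sub>E S" for e
        using glue_in[OF t, of e "{i}"] that S i(1) by (auto simp: insert_absorb PiE_iff)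
      then show ?thesis unfolding g_def using f finS S
        by (intro conjI avg_nonneg avg_le) (auto simp: words_finite words_nonempty)
    qed
    moreover have "n \<le> card (J - {i})" using J i(1) by simp
    ultimately obtain I where I: "I \<subseteq> J - {i}" "card I = m"
      "avg ((J - {i}) \<rightarrow>\<^sub>E T) g - \<epsilon> / 2 \<le> avg ((J - {i} - I) \<rightarrow>\<^sub>E T) (\<lambda>t. avg (I \<rightarrow>\<^sub>E S) (\<lambda>e. g (glue (J - {i} - I) t e)))"
      using n[rule_format, of "J - {i}" T S g] J T S by blast
    let ?I = "I \<union> {i}"
    have eq: "J - {i} - I = J - ?I" by auto
    have "avg (?I \<rightarrow>\<^sub>E S) (\<lambda>e. f (glue (J - ?I) t e)) = avg (I \<rightarrow>\<^sub>E S) (\<lambda>e. g (glue (J - ?I) t e))" for t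
    proof -
      have "glue (J - ?I) t (glue I x e) = glue (J - {i}) (glue (J - ?I) t x) e" for x e
        using I(1) i(1) by (auto simp: glue_def fun_eq_iff)
      then show ?thesis using I(1) by (subst avg_glue) (auto simp: g_def)
    qed
    then have "avg (J \<rightarrow>\<^sub>E T) f - \<epsilon> \<le> avg ((J - ?I) \<rightarrow>\<^sub>E T) (\<lambda>t. avg (?I \<rightarrow>\<^sub>E S) (\<lambda>e. f (glue (J - ?I) t e)))"
      using i(2) I(3) unfolding eq g_def[symmetric] by simp
    moreover have "card ?I = Suc m" using I i(1) J(1) finite_subset[OF I(1)] by (subst card_Un_disjoint) auto
    ultimately show "\<exists>I\<subseteq>J. card I = Suc m \<and>
      avg (J \<rightarrow>\<^sub>E T) f - \<epsilon> \<le> avg ((J - I) \<rightarrow>\<^sub>E T) (\<lambda>t. avg (I \<rightarrow>\<^sub>E S) (\<lambda>e. f (glue (J - I) t e)))"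
      using I(1) i(1) by (intro exI[of _ ?I]) auto
  qed
qed

section \<open>Combinatorial subspaces\<close>

text \<open>A subspace is presented by a pattern, which prescribes at every coordinate either a fixed
  letter (\<open>Inl\<close>) or a variable (\<open>Inr\<close>); filling in values for the variables gives its points.
  Since every variable occurs, filling is injective, and averages over a subspace can be taken
  over the values of the variables. Coordinates and variables have the same type, so that a
  subspace is again a space of words and patterns can be composed.\<close>

definition fill :: "nat set \<Rightarrow> (nat \<Rightarrow> 'a + nat) \<Rightarrow> (nat \<Rightarrow> 'a) \<Rightarrow> nat \<Rightarrow> 'a" where
  "fill J \<tau> x = (\<lambda>j\<in>J. case \<tau> j of Inl a \<Rightarrow> a | Inr d \<Rightarrow> x d)"

definition patterns :: "'a set \<Rightarrow> nat set \<Rightarrow> nat set \<Rightarrow> (nat \<Rightarrow> 'a + nat) set" where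
  "patterns S D J = {\<tau> \<in> J \<rightarrow>\<^sub>E (S <+> D). \<forall>d\<in>D. \<exists>j\<in>J. \<tau> j = Inr d}"

definition constant_pattern :: "nat set \<Rightarrow> (nat \<Rightarrow> 'a) \<Rightarrow> nat \<Rightarrow> 'a + nat" where
  "constant_pattern J w = (\<lambda>j\<in>J. Inl (w j))"

definition compose_pattern ::
    "nat set \<Rightarrow> (nat \<Rightarrow> 'a + nat) \<Rightarrow> (nat \<Rightarrow> 'a + nat) \<Rightarrow> nat \<Rightarrow> 'a + nat" where
  "compose_pattern J \<tau> \<sigma> = (\<lambda>j\<in>J. case \<tau> j of Inl a \<Rightarrow> Inl a | Inr d \<Rightarrow> \<sigma> d)"

lemma patterns_finite: "finite S \<Longrightarrow> finite D \<Longrightarrow> finite J \<Longrightarrow> finite (patterns S D J)"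
  unfolding patterns_def by (simp add: finite_PiE)

lemma card_patterns_le:
  assumes "finite S" "finite J"
  shows "card (patterns S {..<m} J) \<le> (card S + m) ^ card J"
proof -
  have "card (patterns S {..<m} J) \<le> card (J \<rightarrow>\<^sub>E (S <+> {..<m}))"
    using assms by (intro card_mono) (auto simp: patterns_def finite_PiE)
  also have "\<dots> = (card S + m) ^ card J" using assms by (simp add: card_PiE card_Plus)
  finally show ?thesis .
qed

lemma letter_or_variable:
  assumes "\<tau> \<in> J \<rightarrow>\<^sub>E (S <+> D)" "j \<in> J"
  obtains (letter) a where "a \<in> S" "\<tau> j = Inl a" | (variable) d where "d \<in> D" "\<tau> j = Inr d"
  using PiE_mem[OF assms] by blast

lemma pattern_word: "\<tau> \<in> patterns S D J \<Longrightarrow> \<tau> \<in> J \<rightarrow>\<^sub>E (S <+> D)"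
  by (simp add: patterns_def)

lemma pattern_variable:
  assumes "\<tau> \<in> patterns S D J" "d \<in> D"
  obtains j where "j \<in> J" "\<tau> j = Inr d"
  using assms unfolding patterns_def by blast

lemma fill_in:
  assumes "\<tau> \<in> J \<rightarrow>\<^sub>E (S <+> D)" "S \<subseteq> S'" "x \<in> D \<rightarrow>\<^sub>E S'"
  shows "fill J \<tau> x \<in> J \<rightarrow>\<^sub>E S'"
proof (rule PiE_I)
  fix j assume j: "j \<in> J"
  from assms(1) j show "fill J \<tau> x j \<in> S'"
    by (rule letter_or_variable) (use j assms(2) PiE_mem[OF assms(3)] in \<open>auto simp: fill_def\<close>)
qed (simp add: fill_def)

lemma patterns_mono:
  assumes "S \<subseteq> S'"
  shows "patterns S D J \<subseteq> patterns S' D J"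
proof -
  have "S <+> D \<subseteq> S' <+> D" using assms by blast
  then show ?thesis unfolding patterns_def using PiE_mono[of J "\<lambda>_. S <+> D" "\<lambda>_. S' <+> D"] by blast
qed

lemma fill_pattern_in: "\<tau> \<in> patterns S D J \<Longrightarrow> x \<in> D \<rightarrow>\<^sub>E S \<Longrightarrow> fill J \<tau> x \<in> J \<rightarrow>\<^sub>E S"
  by (rule fill_in[of \<tau> J S D S]) (auto simp: patterns_def)

lemma inj_on_fill:
  assumes "\<tau> \<in> patterns S D J"
  shows "inj_on (fill J \<tau>) (D \<rightarrow>\<^sub>E S)"
proof (rule inj_onI)
  fix x y assume x: "x \<in> D \<rightarrow>\<^sub>E S" and y: "y \<in> D \<rightarrow>\<^sub>E S" and eq: "fill J \<tau> x = fill J \<tau> y"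
  have "x d = y d" if "d \<in> D" for d
  proof -
    obtain j where "j \<in> J" "\<tau> j = Inr d" using pattern_variable[OF assms \<open>d \<in> D\<close>] .
    then show ?thesis using fun_cong[OF eq, of j] by (simp add: fill_def)
  qed
  then show "x = y" using x y by (meson PiE_ext)
qed

lemma constant_pattern_in: "w \<in> J \<rightarrow>\<^sub>E S \<Longrightarrow> constant_pattern J w \<in> patterns S {} J"
  by (auto simp: constant_pattern_def patterns_def)

lemma fill_constant_pattern: "w \<in> J \<rightarrow>\<^sub>E S \<Longrightarrow> fill J (constant_pattern J w) x = w"
  by (auto simp: constant_pattern_def fill_def fun_eq_iff PiE_iff extensional_def)

lemma glue_pattern_in:
  assumes "\<tau> \<in> patterns S D I" "\<sigma> \<in> patterns S E J" "I \<inter> J = {}"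
  shows "glue I \<tau> \<sigma> \<in> patterns S (D \<union> E) (I \<union> J)"
proof -
  have "\<tau> \<in> I \<rightarrow>\<^sub>E (S <+> (D \<union> E))" "\<sigma> \<in> J \<rightarrow>\<^sub>E (S <+> (D \<union> E))"
    using assms PiE_mono[of I "\<lambda>_. S <+> D" "\<lambda>_. S <+> (D \<union> E)"]
      PiE_mono[of J "\<lambda>_. S <+> E" "\<lambda>_. S <+> (D \<union> E)"] by (auto simp: patterns_def)
  moreover have "\<exists>j\<in>I \<union> J. glue I \<tau> \<sigma> j = Inr d" if "d \<in> D \<union> E" for d
  proof (cases "d \<in> D")
    case True
    then obtain j where "j \<in> I" "\<tau> j = Inr d" using pattern_variable[OF assms(1)] by blast
    then show ?thesis by (intro bexI[of _ j]) (simp_all add: glue_def)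
  next
    case False
    then have "d \<in> E" using that by simp
    then obtain j where "j \<in> J" "\<sigma> j = Inr d" using pattern_variable[OF assms(2)] by blast
    then show ?thesis using assms(3) by (intro bexI[of _ j]) (auto simp: glue_def)
  qed
  ultimately show ?thesis by (simp add: patterns_def glue_in)
qed

lemma fill_glue: "fill (I \<union> J) (glue I \<tau> \<sigma>) x = glue I (fill I \<tau> x) (fill J \<sigma> x)"
  by (auto simp: fill_def glue_def fun_eq_iff)

lemma compose_pattern_word:
  assumes "\<tau> \<in> J \<rightarrow>\<^sub>E (S <+> D)" "\<sigma> \<in> D \<rightarrow>\<^sub>E (S <+> E)"
  shows "compose_pattern J \<tau> \<sigma> \<in> J \<rightarrow>\<^sub>E (S <+> E)"
proof (rule PiE_I)
  fix j assume j: "j \<in> J"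
  from assms(1) j show "compose_pattern J \<tau> \<sigma> j \<in> S <+> E"
    by (rule letter_or_variable) (use j PiE_mem[OF assms(2)] in \<open>auto simp: compose_pattern_def\<close>)
qed (simp add: compose_pattern_def)

lemma compose_pattern_in:
  assumes "\<tau> \<in> patterns S D J" "\<sigma> \<in> patterns S E D"
  shows "compose_pattern J \<tau> \<sigma> \<in> patterns S E J"
proof -
  have "compose_pattern J \<tau> \<sigma> \<in> J \<rightarrow>\<^sub>E (S <+> E)"
    by (rule compose_pattern_word[OF assms[THEN pattern_word]])
  moreover have "\<exists>j\<in>J. compose_pattern J \<tau> \<sigma> j = Inr e" if "e \<in> E" for e
  proof -
    obtain d where d: "d \<in> D" "\<sigma> d = Inr e" using pattern_variable[OF assms(2) \<open>e \<in> E\<close>] .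
    moreover obtain j where "j \<in> J" "\<tau> j = Inr d" using pattern_variable[OF assms(1) d(1)] .
    ultimately show ?thesis by (intro bexI[of _ j]) (simp_all add: compose_pattern_def)
  qed
  ultimately show ?thesis by (simp add: patterns_def)
qed

lemma fill_cong:
  assumes "\<tau> \<in> J \<rightarrow>\<^sub>E (S <+> D)" "\<And>d. d \<in> D \<Longrightarrow> x d = y d"
  shows "fill J \<tau> x = fill J \<tau> y"
proof
  fix j
  show "fill J \<tau> x j = fill J \<tau> y j"
  proof (cases "j \<in> J")
    case True
    from assms(1) True show ?thesis
      by (rule letter_or_variable) (use assms(2) in \<open>auto simp: fill_def\<close>)
  qed (simp add: fill_def)
qed

lemma fill_compose:
  assumes "\<tau> \<in> J \<rightarrow>\<^sub>E (S <+> D)"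
  shows "fill J (compose_pattern J \<tau> \<sigma>) x = fill J \<tau> (fill D \<sigma> x)"
proof
  fix j
  show "fill J (compose_pattern J \<tau> \<sigma>) x j = fill J \<tau> (fill D \<sigma> x) j"
  proof (cases "j \<in> J")
    case True
    from assms True show ?thesis
      by (rule letter_or_variable) (use True in \<open>auto simp: fill_def compose_pattern_def\<close>)
  qed (simp add: fill_def)
qed

text \<open>The fibre of words that extend a given word \<open>t\<close> on \<open>J\<close> is itself a subspace.\<close>

definition fibre_pattern :: "nat set \<Rightarrow> (nat \<Rightarrow> 'a) \<Rightarrow> nat set \<Rightarrow> nat \<Rightarrow> 'a + nat" where
  "fibre_pattern J t I = glue J (constant_pattern J t) (\<lambda>i\<in>I. Inr i)"

lemma fibre_pattern_in:
  assumes "t \<in> J \<rightarrow>\<^sub>E S" "J \<inter> I = {}"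
  shows "fibre_pattern J t I \<in> patterns S I (J \<union> I)"
proof -
  have "(\<lambda>i\<in>I. Inr i) \<in> patterns S I I" by (auto simp: patterns_def)
  from glue_pattern_in[OF constant_pattern_in[OF assms(1)] this assms(2)]
  show ?thesis by (simp add: fibre_pattern_def)
qed

lemma fill_fibre_pattern:
  assumes "t \<in> J \<rightarrow>\<^sub>E S" "e \<in> I \<rightarrow>\<^sub>E S"
  shows "fill (J \<union> I) (fibre_pattern J t I) e = glue J t e"
proof -
  have "fill I (\<lambda>i\<in>I. Inr i) e = e"
    using PiE_arb[OF assms(2)] by (auto simp: fill_def fun_eq_iff)
  then show ?thesis using assms by (simp add: fibre_pattern_def fill_glue fill_constant_pattern)
qed

text \<open>Subspaces of dimension 1 are the combinatorial lines.\<close>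

definition has_subspace :: "'a set \<Rightarrow> nat \<Rightarrow> nat set \<Rightarrow> (nat \<Rightarrow> 'a) set \<Rightarrow> bool" where
  "has_subspace S m J A \<longleftrightarrow> (\<exists>\<tau>\<in>patterns S {..<m} J. \<forall>x\<in>{..<m} \<rightarrow>\<^sub>E S. fill J \<tau> x \<in> A)"

definition density_forces_subspace :: "'a set \<Rightarrow> nat \<Rightarrow> real \<Rightarrow> bool" where
  "density_forces_subspace S m \<delta> \<longleftrightarrow> (\<exists>n. \<forall>J A. finite J \<longrightarrow> n \<le> card J \<longrightarrow> A \<subseteq> J \<rightarrow>\<^sub>E S \<longrightarrow>
     \<delta> \<le> avg (J \<rightarrow>\<^sub>E S) (\<lambda>w. of_bool (w \<in> A)) \<longrightarrow> has_subspace S m J A)"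

lemma has_subspace_pullback:
  assumes "\<tau> \<in> patterns S D J" "has_subspace S m D {x \<in> D \<rightarrow>\<^sub>E S. fill J \<tau> x \<in> A}"
  shows "has_subspace S m J A"
proof -
  obtain \<sigma> where \<sigma>: "\<sigma> \<in> patterns S {..<m} D" "\<forall>x\<in>{..<m} \<rightarrow>\<^sub>E S. fill J \<tau> (fill D \<sigma> x) \<in> A"
    using assms(2) by (auto simp: has_subspace_def)
  moreover have "fill J (compose_pattern J \<tau> \<sigma>) x = fill J \<tau> (fill D \<sigma> x)" for x
    using assms(1) by (intro fill_compose[of _ _ S]) (simp add: patterns_def)
  ultimately show ?thesis
    using compose_pattern_in[OF assms(1) \<sigma>(1)] unfolding has_subspace_def
    by (intro bexI[of _ "compose_pattern J \<tau> \<sigma>"]) simp_all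
qed

lemma has_subspace_fibre:
  assumes t: "t \<in> J \<rightarrow>\<^sub>E S" "J \<inter> I = {}" and sub: "has_subspace S m I {e \<in> I \<rightarrow>\<^sub>E S. glue J t e \<in> A}"
  shows "has_subspace S m (J \<union> I) A"
proof (rule has_subspace_pullback[OF fibre_pattern_in[OF t]])
  have "{e \<in> I \<rightarrow>\<^sub>E S. glue J t e \<in> A} = {e \<in> I \<rightarrow>\<^sub>E S. fill (J \<union> I) (fibre_pattern J t I) e \<in> A}"
    using fill_fibre_pattern[OF t(1)] by (intro Collect_cong conj_cong refl) simp
  then show "has_subspace S m I {e \<in> I \<rightarrow>\<^sub>E S. fill (J \<union> I) (fibre_pattern J t I) e \<in> A}"
    using sub by simp
qed

lemma density_forces_subspace_mono:
  assumes "density_forces_subspace S m \<delta>" "\<delta> \<le> \<epsilon>"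
  shows "density_forces_subspace S m \<epsilon>"
proof -
  obtain n where "\<forall>J A. finite J \<longrightarrow> n \<le> card J \<longrightarrow> A \<subseteq> J \<rightarrow>\<^sub>E S \<longrightarrow>
     \<delta> \<le> avg (J \<rightarrow>\<^sub>E S) (\<lambda>w. of_bool (w \<in> A)) \<longrightarrow> has_subspace S m J A"
    using assms(1) unfolding density_forces_subspace_def by blast
  then show ?thesis
    using assms(2) unfolding density_forces_subspace_def by (intro exI[of _ n]) (meson order_trans)
qed

text \<open>Subspaces of dimension \<open>m + 1\<close> arise from a subspace of dimension \<open>m\<close> that is common to
  many fibres, by finding a line in the set of those fibres.\<close>

lemma density_forces_subspaces:
  assumes S: "finite S" "S \<noteq> {}" and lines: "\<And>\<delta>. \<delta> > 0 \<Longrightarrow> density_forces_subspace S 1 \<delta>"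
    and "\<delta> > 0"
  shows "density_forces_subspace S m \<delta>"
  using \<open>\<delta> > 0\<close>
proof (induction m arbitrary: \<delta>)
  case 0
  have "has_subspace S 0 J A" if "A \<subseteq> J \<rightarrow>\<^sub>E S" "\<delta> \<le> avg (J \<rightarrow>\<^sub>E S) (\<lambda>w. of_bool (w \<in> A))" for J A
  proof -
    have "A \<noteq> {}" using that(2) 0 by (force simp: avg_def)
    then obtain w where "w \<in> A" by blast
    moreover have "w \<in> J \<rightarrow>\<^sub>E S" by (rule subsetD[OF that(1) \<open>w \<in> A\<close>])
    ultimately have "constant_pattern J w \<in> patterns S {..<0} J" "fill J (constant_pattern J w) x \<in> A" for x
      by (simp_all add: fill_constant_pattern constant_pattern_in)
    then show ?thesis unfolding has_subspace_def by blast
  qed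
  then show ?case unfolding density_forces_subspace_def by blast
next
  case (Suc m)
  have half: "\<delta> / 2 > 0" using Suc.prems by simp
  obtain n1 where n1: "\<And>J A. finite J \<Longrightarrow> n1 \<le> card J \<Longrightarrow> A \<subseteq> J \<rightarrow>\<^sub>E S \<Longrightarrow>
     \<delta> / 2 \<le> avg (J \<rightarrow>\<^sub>E S) (\<lambda>w. of_bool (w \<in> A)) \<Longrightarrow> has_subspace S m J A"
    using Suc.IH[OF half] unfolding density_forces_subspace_def by blast
  define b where "b = real ((card S + m) ^ n1)"
  have "0 < card S" using S by (simp add: card_gt_0_iff)
  then have "b > 0" by (simp add: b_def add_pos_nonneg)
  then have "\<delta> / (2 * b) > 0" using Suc.prems by simp
  from lines[OF this] obtain n2 where n2: "\<And>J A. finite J \<Longrightarrow> n2 \<le> card J \<Longrightarrow> A \<subseteq> J \<rightarrow>\<^sub>E S \<Longrightarrow>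
     \<delta> / (2 * b) \<le> avg (J \<rightarrow>\<^sub>E S) (\<lambda>w. of_bool (w \<in> A)) \<Longrightarrow> has_subspace S 1 J A"
    unfolding density_forces_subspace_def by blast
  have "has_subspace S (Suc m) J A" if J: "finite J" "n1 + n2 \<le> card J" and A: "A \<subseteq> J \<rightarrow>\<^sub>E S"
    and dense: "\<delta> \<le> avg (J \<rightarrow>\<^sub>E S) (\<lambda>w. of_bool (w \<in> A))" for J A
  proof -
    obtain I where I: "I \<subseteq> J" "card I = n1" "finite I"
      using obtain_subset_with_card_n[of n1 J] J by auto
    define Y where "Y = J - I"
    have Y: "finite Y" "n2 \<le> card Y" "I \<inter> Y = {}" "I \<union> Y = J"
      using J I by (auto simp: Y_def card_Diff_subset)
    obtain \<tau> where \<tau>: "\<tau> \<in> patterns S {..<m} I" and many: "\<delta> / (2 * b) \<le>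
      avg (Y \<rightarrow>\<^sub>E S) (\<lambda>y. of_bool (\<forall>x\<in>fill I \<tau> ` ({..<m} \<rightarrow>\<^sub>E S). glue I x y \<in> A))"
    proof (rule common_configuration[of "I \<rightarrow>\<^sub>E S" "Y \<rightarrow>\<^sub>E S" "patterns S {..<m} I" b \<delta>
          "\<lambda>x y. glue I x y \<in> A" "\<lambda>\<tau>. fill I \<tau> ` ({..<m} \<rightarrow>\<^sub>E S)"])
      show "real (card (patterns S {..<m} I)) \<le> b"
        using card_patterns_le[of S I m] S I unfolding b_def by (simp flip: of_nat_power of_nat_add)
      show "\<delta> \<le> avg (Y \<rightarrow>\<^sub>E S) (\<lambda>y. avg (I \<rightarrow>\<^sub>E S) (\<lambda>x. of_bool (glue I x y \<in> A)))"
        using dense avg_glue[OF Y(3), of S] unfolding Y(4) by (subst avg_swap) simp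
      show "\<exists>\<tau>\<in>patterns S {..<m} I. fill I \<tau> ` ({..<m} \<rightarrow>\<^sub>E S) \<subseteq> A'"
        if "A' \<subseteq> I \<rightarrow>\<^sub>E S" "\<delta> / 2 \<le> avg (I \<rightarrow>\<^sub>E S) (\<lambda>x. of_bool (x \<in> A'))" for A'
        using n1[of I A'] that I by (auto simp: has_subspace_def)
    qed (use S I Y Suc.prems in \<open>auto simp: words_finite words_nonempty patterns_finite\<close>)
    let ?B = "{y \<in> Y \<rightarrow>\<^sub>E S. \<forall>x\<in>{..<m} \<rightarrow>\<^sub>E S. glue I (fill I \<tau> x) y \<in> A}"
    have "has_subspace S 1 Y ?B"
    proof (rule n2)
      show "\<delta> / (2 * b) \<le> avg (Y \<rightarrow>\<^sub>E S) (\<lambda>w. of_bool (w \<in> ?B))"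
        using many by (rule order_trans) (auto intro: avg_mono)
    qed (use Y in auto)
    then obtain \<sigma> where \<sigma>: "\<sigma> \<in> patterns S {..<1} Y" "\<forall>x\<in>{..<1} \<rightarrow>\<^sub>E S. fill Y \<sigma> x \<in> ?B"
      by (auto simp: has_subspace_def)
    \<comment> \<open>The variable 0 of the line is renamed to the new variable \<open>m\<close>.\<close>
    define \<sigma>' where "\<sigma>' = compose_pattern Y \<sigma> (\<lambda>d\<in>{..<1}. Inr m)"
    have "(\<lambda>d\<in>{..<1}. Inr m) \<in> patterns S {m} {..<1}" by (auto simp: patterns_def)
    then have "\<sigma>' \<in> patterns S {m} Y" unfolding \<sigma>'_def by (rule compose_pattern_in[OF \<sigma>(1)])
    then have "glue I \<tau> \<sigma>' \<in> patterns S ({..<m} \<union> {m}) (I \<union> Y)" by (rule glue_pattern_in[OF \<tau> _ Y(3)])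
    moreover have "{..<m} \<union> {m} = {..<Suc m}" by auto
    ultimately have "glue I \<tau> \<sigma>' \<in> patterns S {..<Suc m} J" using Y(4) by simp
    moreover have "fill J (glue I \<tau> \<sigma>') x \<in> A" if x: "x \<in> {..<Suc m} \<rightarrow>\<^sub>E S" for x
    proof -
      have eq1: "fill I \<tau> x = fill I \<tau> (restrict x {..<m})"
        by (rule fill_cong[OF pattern_word[OF \<tau>]]) simp
      have eq2: "fill Y \<sigma>' x = fill Y \<sigma> (\<lambda>d\<in>{..<1}. x m)"
        unfolding \<sigma>'_def fill_compose[OF pattern_word[OF \<sigma>(1)]]
        by (rule fill_cong[OF pattern_word[OF \<sigma>(1)]]) (simp add: fill_def)
      have x': "(\<lambda>d\<in>{..<1}. x m) \<in> {..<1} \<rightarrow>\<^sub>E S" "restrict x {..<m} \<in> {..<m} \<rightarrow>\<^sub>E S"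
        using PiE_mem[OF x] by (auto simp: PiE_iff)
      have "fill Y \<sigma> (\<lambda>d\<in>{..<1}. x m) \<in> ?B" using \<sigma>(2) x'(1) by (rule bspec)
      then have "glue I (fill I \<tau> x) (fill Y \<sigma>' x) \<in> A" using x'(2) by (simp add: eq1 eq2)
      then show ?thesis using fill_glue[of I Y \<tau> \<sigma>' x] Y(4) by simp
    qed
    ultimately show ?thesis unfolding has_subspace_def by blast
  qed
  then show ?case unfolding density_forces_subspace_def by blast
qed

section \<open>Insensitive sets\<close>

text \<open>The inductive step of the theorem: the density version is known, in every dimension, for the
  alphabet \<open>K\<close>, and one new letter \<open>z\<close> is added.\<close>

locale new_letter =
  fixes K :: "'a set" and z :: 'a
  assumes K: "finite K" "K \<noteq> {}" and z: "z \<notin> K"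
    and K_dense: "\<And>m \<delta>. \<delta> > 0 \<Longrightarrow> density_forces_subspace K m \<delta>"
begin

definition Q :: "'a set" where "Q = insert z K"

definition demote :: "'a \<Rightarrow> 'a \<Rightarrow> 'a" where
  "demote a c = (if c = z then a else c)"

text \<open>Two words agree after \<open>demote a\<close> iff one arises from the other by exchanging the letters \<open>a\<close> and
  \<open>z\<close> at some coordinates; insensitive sets do not distinguish such words.\<close>

definition insensitive :: "nat set \<Rightarrow> 'a \<Rightarrow> ((nat \<Rightarrow> 'a) \<Rightarrow> bool) \<Rightarrow> bool" where
  "insensitive J a D \<longleftrightarrow> (\<forall>x\<in>J \<rightarrow>\<^sub>E Q. \<forall>y\<in>J \<rightarrow>\<^sub>E Q.
     (\<forall>j\<in>J. demote a (x j) = demote a (y j)) \<longrightarrow> D x \<longrightarrow> D y)"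

text \<open>In the application \<open>f\<close> is the indicator of a set minus a constant, so that \<open>nonpos\<close> bounds the
  density of the set on every subspace of dimension \<open>m\<close>.\<close>

definition nonpos :: "nat \<Rightarrow> nat set \<Rightarrow> ((nat \<Rightarrow> 'a) \<Rightarrow> real) \<Rightarrow> bool" where
  "nonpos m J f \<longleftrightarrow> (\<forall>\<tau>\<in>patterns Q {..<m} J. avg ({..<m} \<rightarrow>\<^sub>E Q) (\<lambda>x. f (fill J \<tau> x)) \<le> 0)"

lemma Q: "finite Q" "Q \<noteq> {}" "K \<subseteq> Q" "z \<in> Q"
  using K by (auto simp: Q_def)

lemma demote_in: "c \<in> Q \<Longrightarrow> a \<in> K \<Longrightarrow> demote a c \<in> K"
  by (auto simp: demote_def Q_def)

lemma words_Q: "finite J \<Longrightarrow> finite (J \<rightarrow>\<^sub>E Q)" "J \<rightarrow>\<^sub>E Q \<noteq> {}" for J :: "nat set"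
  using Q by (simp_all add: words_finite words_nonempty)

lemma insensitiveD:
  "insensitive J a D \<Longrightarrow> x \<in> J \<rightarrow>\<^sub>E Q \<Longrightarrow> y \<in> J \<rightarrow>\<^sub>E Q \<Longrightarrow>
    (\<And>j. j \<in> J \<Longrightarrow> demote a (x j) = demote a (y j)) \<Longrightarrow> D x \<Longrightarrow> D y"
  unfolding insensitive_def by blast

lemma insensitive_not: "insensitive J a D \<Longrightarrow> insensitive J a (\<lambda>x. \<not> D x)"
  unfolding insensitive_def by metis

lemma insensitive_conj:
  "insensitive J a D \<Longrightarrow> insensitive J a D' \<Longrightarrow> insensitive J a (\<lambda>x. D x \<and> D' x)"
  unfolding insensitive_def by blast

lemma insensitive_ball:
  "(\<And>i. i \<in> B \<Longrightarrow> insensitive J a (D i)) \<Longrightarrow> insensitive J a (\<lambda>x. \<forall>i\<in>B. D i x)"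
  unfolding insensitive_def by blast

lemma insensitive_const: "insensitive J a (\<lambda>_. P)"
  unfolding insensitive_def by blast

lemma insensitive_fill:
  assumes "insensitive J a D" "\<tau> \<in> patterns Q E J"
  shows "insensitive E a (\<lambda>x. D (fill J \<tau> x))"
  unfolding insensitive_def
proof (intro ballI impI)
  fix x y assume x: "x \<in> E \<rightarrow>\<^sub>E Q" and y: "y \<in> E \<rightarrow>\<^sub>E Q"
    and xy: "\<forall>j\<in>E. demote a (x j) = demote a (y j)" and D: "D (fill J \<tau> x)"
  show "D (fill J \<tau> y)"
  proof (rule insensitiveD[OF assms(1) fill_pattern_in[OF assms(2) x] fill_pattern_in[OF assms(2) y] _ D])
    fix j assume j: "j \<in> J"
    from pattern_word[OF assms(2)] j show "demote a (fill J \<tau> x j) = demote a (fill J \<tau> y j)"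
      by (rule letter_or_variable) (use j xy in \<open>auto simp: fill_def\<close>)
  qed
qed

lemma insensitive_fibre:
  assumes "insensitive (J \<union> I) a D" "t \<in> J \<rightarrow>\<^sub>E Q" "J \<inter> I = {}"
  shows "insensitive I a (\<lambda>e. D (glue J t e))"
  unfolding insensitive_def
proof (intro ballI impI)
  fix x y assume x: "x \<in> I \<rightarrow>\<^sub>E Q" and y: "y \<in> I \<rightarrow>\<^sub>E Q"
    and xy: "\<forall>j\<in>I. demote a (x j) = demote a (y j)" and D: "D (glue J t x)"
  show "D (glue J t y)"
    by (rule insensitiveD[OF assms(1) glue_in[OF assms(2) x] glue_in[OF assms(2) y] _ D])
      (use xy in \<open>auto simp: glue_def\<close>)
qed

lemma nonpos_fill:
  assumes "nonpos m J f" "\<tau> \<in> patterns Q E J"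
  shows "nonpos m E (\<lambda>x. f (fill J \<tau> x))"
  unfolding nonpos_def
proof
  fix \<sigma> assume \<sigma>: "\<sigma> \<in> patterns Q {..<m} E"
  from compose_pattern_in[OF assms(2) \<sigma>]
  have "avg ({..<m} \<rightarrow>\<^sub>E Q) (\<lambda>x. f (fill J (compose_pattern J \<tau> \<sigma>) x)) \<le> 0"
    using assms(1) unfolding nonpos_def by blast
  then show "avg ({..<m} \<rightarrow>\<^sub>E Q) (\<lambda>x. f (fill J \<tau> (fill E \<sigma> x))) \<le> 0"
    by (simp add: fill_compose[OF pattern_word[OF assms(2)]])
qed

lemma nonpos_fibre:
  assumes "nonpos m (J \<union> I) f" "t \<in> J \<rightarrow>\<^sub>E Q" "J \<inter> I = {}"
  shows "nonpos m I (\<lambda>e. f (glue J t e))"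
  unfolding nonpos_def
proof
  fix \<sigma> assume \<sigma>: "\<sigma> \<in> patterns Q {..<m} I"
  have "avg ({..<m} \<rightarrow>\<^sub>E Q) (\<lambda>x. f (glue J t (fill I \<sigma> x)))
      = avg ({..<m} \<rightarrow>\<^sub>E Q) (\<lambda>x. f (fill (J \<union> I) (fibre_pattern J t I) (fill I \<sigma> x)))"
    by (rule avg_cong) (simp add: fill_fibre_pattern[OF assms(2) fill_pattern_in[OF \<sigma>]])
  also have "\<dots> \<le> 0"
    using nonpos_fill[OF assms(1) fibre_pattern_in[OF assms(2,3)]] \<sigma> unfolding nonpos_def by blast
  finally show "avg ({..<m} \<rightarrow>\<^sub>E Q) (\<lambda>x. f (glue J t (fill I \<sigma> x))) \<le> 0" .
qed

text \<open>This is trivial for \<open>\<mu> = 1\<close>, and the aim is to reach \<open>\<mu> = 0\<close> up to a change of \<open>\<beta>\<close>. Having the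
  density of \<open>D\<close> in the bound makes it linear, so that it can be averaged over fibres in which the
  densities differ.\<close>

definition insensitive_bound :: "nat \<Rightarrow> real \<Rightarrow> real \<Rightarrow> bool" where
  "insensitive_bound m \<beta> \<mu> \<longleftrightarrow> (\<exists>n. \<forall>J a D f. finite J \<longrightarrow> n \<le> card J \<longrightarrow> a \<in> K \<longrightarrow>
     insensitive J a D \<longrightarrow> (\<forall>x\<in>J \<rightarrow>\<^sub>E Q. f x \<le> 1) \<longrightarrow> nonpos m J f \<longrightarrow>
     avg (J \<rightarrow>\<^sub>E Q) (\<lambda>x. f x * of_bool (D x)) \<le> \<beta> + \<mu> * avg (J \<rightarrow>\<^sub>E Q) (\<lambda>x. of_bool (D x)))"

text \<open>If \<open>D\<close> is insensitive and a fibre of \<open>D\<close> contains the words over \<open>K\<close> of a subspace, then it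
  contains the whole subspace over \<open>Q\<close>, as \<open>z\<close> can be demoted to \<open>a\<close>. Removing this subspace from
  all the fibres that contain it does not lower the sum of \<open>f\<close> over \<open>D\<close>, because \<open>f\<close> has
  nonpositive average on each copy, but it makes \<open>D\<close> smaller. What is left need not be insensitive
  in the coordinates \<open>I\<close> of the subspace, but it still is in the coordinates \<open>Y\<close>, once those in \<open>I\<close>
  are fixed, since the set of fibres that contain the subspace is insensitive itself.\<close>

lemma remove_subspaces:
  fixes \<theta> :: real and \<tau> :: "nat \<Rightarrow> 'a + nat"
  assumes J: "finite Y" "finite I" "Y \<inter> I = {}" and a: "a \<in> K"
    and D: "insensitive (Y \<union> I) a D"
    and f: "nonpos m (Y \<union> I) f"
    and \<tau>: "\<tau> \<in> patterns K {..<m} I"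
    and many: "\<theta> \<le> avg (Y \<rightarrow>\<^sub>E Q) (\<lambda>t. of_bool (\<forall>e\<in>fill I \<tau> ` ({..<m} \<rightarrow>\<^sub>E K). D (glue Y t e)))"
  obtains D' where "\<And>e. e \<in> I \<rightarrow>\<^sub>E Q \<Longrightarrow> insensitive Y a (\<lambda>t. D' t e)"
    "avg ((Y \<union> I) \<rightarrow>\<^sub>E Q) (\<lambda>x. f x * of_bool (D x)) \<le>
      avg (I \<rightarrow>\<^sub>E Q) (\<lambda>e. avg (Y \<rightarrow>\<^sub>E Q) (\<lambda>t. f (glue I e t) * of_bool (D' t e)))"
    "avg (I \<rightarrow>\<^sub>E Q) (\<lambda>e. avg (Y \<rightarrow>\<^sub>E Q) (\<lambda>t. of_bool (D' t e))) \<le>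
      avg ((Y \<union> I) \<rightarrow>\<^sub>E Q) (\<lambda>x. of_bool (D x)) - \<theta> / real (card Q) ^ card I"
proof -
  let ?WY = "Y \<rightarrow>\<^sub>E Q" and ?WI = "I \<rightarrow>\<^sub>E Q" and ?P = "{..<m} \<rightarrow>\<^sub>E Q"
  have \<tau>Q: "\<tau> \<in> patterns Q {..<m} I" using \<tau> patterns_mono[OF Q(3)] by blast
  define Z where "Z = fill I \<tau> ` ?P"
  have Z: "Z \<subseteq> ?WI" unfolding Z_def using fill_pattern_in[OF \<tau>Q] by blast
  define G where "G t = (\<forall>e\<in>Z. D (glue Y t e))" for t
  define D' where "D' t e = (D (glue Y t e) \<and> \<not> (G t \<and> e \<in> Z))" for t e
  have comm: "glue Y t e = glue I e t" if "t \<in> ?WY" "e \<in> ?WI" for t e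
    using glue_commute[OF that J(3)] .
  have IY: "I \<inter> Y = {}" "I \<union> Y = Y \<union> I" using J(3) by auto
  have ins: "insensitive Y a (\<lambda>t. D (glue Y t e))" if e: "e \<in> ?WI" for e
  proof -
    have "insensitive Y a (\<lambda>t. D (glue I e t))"
      using insensitive_fibre[of I Y a D e] D e IY by simp
    then show ?thesis using comm[OF _ e] unfolding insensitive_def by metis
  qed
  have ins_D': "insensitive Y a (\<lambda>t. D' t e)" if "e \<in> ?WI" for e
    unfolding D'_def G_def using ins Z that
    by (intro insensitive_conj insensitive_not insensitive_ball insensitive_const) auto
  have G: "G t" if t: "t \<in> ?WY" and all: "\<forall>e\<in>fill I \<tau> ` ({..<m} \<rightarrow>\<^sub>E K). D (glue Y t e)" for t
    unfolding G_def Z_def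
  proof (rule ballI, elim imageE)
    fix e x assume e: "e = fill I \<tau> x" and x: "x \<in> ?P"
    let ?x = "\<lambda>d\<in>{..<m}. demote a (x d)"
    have x': "?x \<in> {..<m} \<rightarrow>\<^sub>E K"
      using demote_in[OF PiE_mem[OF x] a] by (auto simp: PiE_iff)
    then have x'': "?x \<in> ?P" using PiE_mono[of "{..<m}" "\<lambda>_. K" "\<lambda>_. Q"] Q(3) by blast
    have eD: "insensitive I a (\<lambda>e. D (glue Y t e))" by (rule insensitive_fibre[OF D t J(3)])
    show "D (glue Y t e)" unfolding e
    proof (rule insensitiveD[OF eD fill_pattern_in[OF \<tau>Q x''] fill_pattern_in[OF \<tau>Q x]])
      show "D (glue Y t (fill I \<tau> ?x))" using all x' by blast
      fix i assume i: "i \<in> I"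
      have "a \<noteq> z" using a z by auto
      from pattern_word[OF \<tau>] i show "demote a (fill I \<tau> ?x i) = demote a (fill I \<tau> x i)"
        by (rule letter_or_variable) (use i \<open>a \<noteq> z\<close> in \<open>auto simp: fill_def demote_def\<close>)
    qed
  qed
  have dens_G: "\<theta> \<le> avg ?WY (\<lambda>t. of_bool (G t))"
    using many by (rule order_trans) (auto intro!: avg_mono simp: G)
  have on_Z: "avg ?WI (\<lambda>e. g e * of_bool (e \<in> Z)) = real (card ?P) / real (card ?WI) * avg ?P (\<lambda>x. g (fill I \<tau> x))" for g
    unfolding Z_def by (rule avg_on_image) (use Z J words_Q inj_on_fill[OF \<tau>Q] Z_def in auto)
  have split: "avg ((Y \<union> I) \<rightarrow>\<^sub>E Q) (\<lambda>x. g x * of_bool (D x)) =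
      avg ?WI (\<lambda>e. avg ?WY (\<lambda>t. g (glue I e t) * of_bool (D' t e)))
      + avg ?WY (\<lambda>t. of_bool (G t) * avg ?WI (\<lambda>e. g (glue Y t e) * of_bool (e \<in> Z)))" for g
  proof -
    have "of_bool (D (glue Y t e)) = of_bool (D' t e) + of_bool (G t) * (of_bool (e \<in> Z) :: real)" for t e
      by (auto simp: D'_def G_def)
    then have "avg ((Y \<union> I) \<rightarrow>\<^sub>E Q) (\<lambda>x. g x * of_bool (D x)) =
       avg ?WY (\<lambda>t. avg ?WI (\<lambda>e. g (glue Y t e) * of_bool (D' t e)
         + of_bool (G t) * (g (glue Y t e) * of_bool (e \<in> Z))))"
      by (simp add: avg_glue[OF J(3)] algebra_simps)
    also have "\<dots> = avg ?WY (\<lambda>t. avg ?WI (\<lambda>e. g (glue Y t e) * of_bool (D' t e)))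
      + avg ?WY (\<lambda>t. of_bool (G t) * avg ?WI (\<lambda>e. g (glue Y t e) * of_bool (e \<in> Z)))"
      by (simp add: avg_add avg_cmult)
    also have "avg ?WY (\<lambda>t. avg ?WI (\<lambda>e. g (glue Y t e) * of_bool (D' t e)))
      = avg ?WI (\<lambda>e. avg ?WY (\<lambda>t. g (glue I e t) * of_bool (D' t e)))"
      by (subst avg_swap) (simp add: comm cong: avg_cong)
    finally show ?thesis .
  qed
  have "avg ?WY (\<lambda>t. of_bool (G t) * avg ?WI (\<lambda>e. f (glue Y t e) * of_bool (e \<in> Z))) \<le> 0"
  proof (rule avg_le)
    fix t assume t: "t \<in> ?WY"
    have "avg ?P (\<lambda>x. f (glue Y t (fill I \<tau> x))) \<le> 0"
      using nonpos_fibre[OF f t J(3)] \<tau>Q unfolding nonpos_def by blast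
    then have "avg ?WI (\<lambda>e. f (glue Y t e) * of_bool (e \<in> Z)) \<le> 0"
      unfolding on_Z by (intro mult_nonneg_nonpos) simp_all
    then show "of_bool (G t) * avg ?WI (\<lambda>e. f (glue Y t e) * of_bool (e \<in> Z)) \<le> 0" by simp
  qed (use J words_Q in auto)
  then have fin1: "avg ((Y \<union> I) \<rightarrow>\<^sub>E Q) (\<lambda>x. f x * of_bool (D x)) \<le>
      avg ?WI (\<lambda>e. avg ?WY (\<lambda>t. f (glue I e t) * of_bool (D' t e)))"
    unfolding split[of f] by simp
  have cQ: "0 < card Q" using Q by (simp add: card_gt_0_iff)
  have "avg ?WI (\<lambda>e. of_bool (e \<in> Z)) = real (card Q) ^ m / real (card Q) ^ card I"
    using on_Z[of "\<lambda>_. 1"] words_Q J by (simp add: avg_const card_PiE)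
  also have "\<dots> \<ge> 1 / real (card Q) ^ card I"
    using cQ by (intro divide_right_mono) simp_all
  finally have Z_dens: "1 / real (card Q) ^ card I \<le> avg ?WI (\<lambda>e. of_bool (e \<in> Z))" .
  have "\<theta> / real (card Q) ^ card I \<le> avg ?WY (\<lambda>t. of_bool (G t)) * (1 / real (card Q) ^ card I)"
    using dens_G by (simp add: divide_right_mono)
  also have "\<dots> \<le> avg ?WY (\<lambda>t. of_bool (G t)) * avg ?WI (\<lambda>e. of_bool (e \<in> Z))"
    by (intro mult_left_mono Z_dens avg_nonneg) simp
  finally have "\<theta> / real (card Q) ^ card I \<le> avg ?WY (\<lambda>t. of_bool (G t) * avg ?WI (\<lambda>e. of_bool (e \<in> Z)))"
    by (simp add: avg_multc)
  then have "avg ?WI (\<lambda>e. avg ?WY (\<lambda>t. of_bool (D' t e))) \<le>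
      avg ((Y \<union> I) \<rightarrow>\<^sub>E Q) (\<lambda>x. of_bool (D x)) - \<theta> / real (card Q) ^ card I"
    using split[of "\<lambda>_. 1"] by simp
  with fin1 ins_D' show ?thesis by (intro that[of D'])
qed

text \<open>A set of density at most \<open>\<beta>\<close> satisfies every bound. In a denser one, sampling gives coordinates \<open>I\<close>
  on which the words over \<open>K\<close> are still dense, the theorem for \<open>K\<close> gives a subspace in many fibres,
  and removing it lowers the density by a fixed amount \<open>c\<close> before the bound with \<open>\<mu>\<close> is applied in
  the coordinates outside \<open>I\<close>.\<close>

lemma insensitive_bound_improve:
  assumes "\<beta> > 0"
  obtains c where "0 < c" "c \<le> 1"
    "\<And>\<mu>. 0 \<le> \<mu> \<Longrightarrow> insensitive_bound m \<beta> \<mu> \<Longrightarrow> insensitive_bound m \<beta> (\<mu> * (1 - c))"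
proof -
  have "\<beta> / 4 > 0" "\<beta> / 2 > 0" using assms by auto
  obtain N where N: "\<And>J A. finite J \<Longrightarrow> N \<le> card J \<Longrightarrow> A \<subseteq> J \<rightarrow>\<^sub>E K \<Longrightarrow>
     \<beta> / 4 \<le> avg (J \<rightarrow>\<^sub>E K) (\<lambda>w. of_bool (w \<in> A)) \<Longrightarrow> has_subspace K m J A"
    using K_dense[OF \<open>\<beta> / 4 > 0\<close>, of m] unfolding density_forces_subspace_def by blast
  from sample_coordinates[OF \<open>\<beta> / 2 > 0\<close>, of "card Q" N]
  obtain n1 where n1: "\<And>(J::nat set) (T::'a set) S f. finite J \<Longrightarrow> n1 \<le> card J \<Longrightarrow> finite T \<Longrightarrow>
    card T \<le> card Q \<Longrightarrow> S \<subseteq> T \<Longrightarrow> S \<noteq> {} \<Longrightarrow> \<forall>t\<in>J \<rightarrow>\<^sub>E T. 0 \<le> f t \<and> f t \<le> 1 \<Longrightarrow>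
    \<exists>I\<subseteq>J. card I = N \<and>
      avg (J \<rightarrow>\<^sub>E T) f - \<beta> / 2 \<le> avg ((J - I) \<rightarrow>\<^sub>E T) (\<lambda>t. avg (I \<rightarrow>\<^sub>E S) (\<lambda>e. f (glue (J - I) t e)))"
    by blast
  define b where "b = real ((card K + m) ^ N)"
  define \<theta> where "\<theta> = (\<beta> / 2) / (2 * b)"
  define c where "c = min 1 (\<theta> / real (card Q) ^ N)"
  have cards: "0 < card K" "0 < card Q" using K Q by (auto simp: card_gt_0_iff)
  then have "b > 0" by (simp add: b_def add_pos_nonneg)
  then have c: "0 < c" "c \<le> 1" using assms cards by (auto simp: c_def \<theta>_def)
  have "insensitive_bound m \<beta> (\<mu> * (1 - c))" if \<mu>: "0 \<le> \<mu>" "insensitive_bound m \<beta> \<mu>" for \<mu>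
  proof -
    obtain n2 where n2: "\<And>J a D f. finite J \<Longrightarrow> n2 \<le> card J \<Longrightarrow> a \<in> K \<Longrightarrow>
     insensitive J a D \<Longrightarrow> \<forall>x\<in>J \<rightarrow>\<^sub>E Q. f x \<le> 1 \<Longrightarrow> nonpos m J f \<Longrightarrow>
     avg (J \<rightarrow>\<^sub>E Q) (\<lambda>x. f x * of_bool (D x)) \<le> \<beta> + \<mu> * avg (J \<rightarrow>\<^sub>E Q) (\<lambda>x. of_bool (D x))"
      using \<mu>(2) unfolding insensitive_bound_def by blast
    have "avg (J \<rightarrow>\<^sub>E Q) (\<lambda>x. f x * of_bool (D x)) \<le> \<beta> + \<mu> * (1 - c) * avg (J \<rightarrow>\<^sub>E Q) (\<lambda>x. of_bool (D x))"
      if J: "finite J" "n1 + n2 + N \<le> card J" and a: "a \<in> K" and D: "insensitive J a D"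
        and f: "\<forall>x\<in>J \<rightarrow>\<^sub>E Q. f x \<le> 1" "nonpos m J f" for J a D f
    proof (cases "avg (J \<rightarrow>\<^sub>E Q) (\<lambda>x. of_bool (D x)) \<le> \<beta>")
      case True
      have "avg (J \<rightarrow>\<^sub>E Q) (\<lambda>x. f x * of_bool (D x)) \<le> avg (J \<rightarrow>\<^sub>E Q) (\<lambda>x. of_bool (D x))"
        using f(1) by (intro avg_mono) auto
      moreover have "0 \<le> \<mu> * (1 - c) * avg (J \<rightarrow>\<^sub>E Q) (\<lambda>x. of_bool (D x))"
        using c \<mu> by (intro mult_nonneg_nonneg avg_nonneg) auto
      ultimately show ?thesis using True by linarith
    next
      case False
      have "n1 \<le> card J" using J by simp
      moreover have "\<forall>t\<in>J \<rightarrow>\<^sub>E Q. 0 \<le> (of_bool (D t) :: real) \<and> of_bool (D t) \<le> (1 :: real)" by simp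
      ultimately obtain I where I: "I \<subseteq> J" "card I = N" and
        samp: "avg (J \<rightarrow>\<^sub>E Q) (\<lambda>x. of_bool (D x)) - \<beta> / 2 \<le>
          avg ((J - I) \<rightarrow>\<^sub>E Q) (\<lambda>t. avg (I \<rightarrow>\<^sub>E K) (\<lambda>e. of_bool (D (glue (J - I) t e))))"
        using n1[of J Q K "\<lambda>x. of_bool (D x)"] J(1) Q K by blast
      define Y where "Y = J - I"
      have Y: "finite Y" "finite I" "Y \<inter> I = {}" "Y \<union> I = J" "n2 \<le> card Y"
        using J I finite_subset[OF I(1) J(1)] by (auto simp: Y_def card_Diff_subset)
      obtain \<tau> where \<tau>: "\<tau> \<in> patterns K {..<m} I" and many: "\<theta> \<le>
        avg (Y \<rightarrow>\<^sub>E Q) (\<lambda>t. of_bool (\<forall>e\<in>fill I \<tau> ` ({..<m} \<rightarrow>\<^sub>E K). D (glue Y t e)))"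
        unfolding \<theta>_def
      proof (rule common_configuration[of "I \<rightarrow>\<^sub>E K" "Y \<rightarrow>\<^sub>E Q" "patterns K {..<m} I" b "\<beta> / 2"
            "\<lambda>e t. D (glue Y t e)" "\<lambda>\<tau>. fill I \<tau> ` ({..<m} \<rightarrow>\<^sub>E K)"])
        show "real (card (patterns K {..<m} I)) \<le> b"
          using card_patterns_le[of K I m] K I Y unfolding b_def by (simp flip: of_nat_power of_nat_add)
        show "\<beta> / 2 \<le> avg (Y \<rightarrow>\<^sub>E Q) (\<lambda>t. avg (I \<rightarrow>\<^sub>E K) (\<lambda>e. of_bool (D (glue Y t e))))"
          using samp False unfolding Y_def by linarith
        show "\<exists>\<tau>\<in>patterns K {..<m} I. fill I \<tau> ` ({..<m} \<rightarrow>\<^sub>E K) \<subseteq> A'"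
          if "A' \<subseteq> I \<rightarrow>\<^sub>E K" "\<beta> / 2 / 2 \<le> avg (I \<rightarrow>\<^sub>E K) (\<lambda>x. of_bool (x \<in> A'))" for A'
          using N[of I A'] that I Y by (auto simp: has_subspace_def)
      qed (use K Y \<open>\<beta> / 2 > 0\<close> in \<open>auto simp: words_Q words_finite words_nonempty patterns_finite\<close>)
      have DJ: "insensitive (Y \<union> I) a D" "nonpos m (Y \<union> I) f" using D f(2) Y(4) by simp_all
      obtain D' where ins: "\<And>e. e \<in> I \<rightarrow>\<^sub>E Q \<Longrightarrow> insensitive Y a (\<lambda>t. D' t e)"
        and split: "avg (J \<rightarrow>\<^sub>E Q) (\<lambda>x. f x * of_bool (D x)) \<le>
          avg (I \<rightarrow>\<^sub>E Q) (\<lambda>e. avg (Y \<rightarrow>\<^sub>E Q) (\<lambda>t. f (glue I e t) * of_bool (D' t e)))"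
        and drop: "avg (I \<rightarrow>\<^sub>E Q) (\<lambda>e. avg (Y \<rightarrow>\<^sub>E Q) (\<lambda>t. of_bool (D' t e))) \<le>
          avg (J \<rightarrow>\<^sub>E Q) (\<lambda>x. of_bool (D x)) - \<theta> / real (card Q) ^ N"
      proof (rule remove_subspaces[OF Y(1,2,3) a DJ \<tau> many, unfolded Y(4) I(2)], goal_cases)
        case (1 D')
        show ?case by (rule 1(1)[OF 1(2-4)])
      qed
      have dens1: "avg (J \<rightarrow>\<^sub>E Q) (\<lambda>x. of_bool (D x)) \<le> 1"
        using J words_Q by (intro avg_le) auto
      have IY: "I \<inter> Y = {}" "I \<union> Y = J" using Y by auto
      note split
      also have "avg (I \<rightarrow>\<^sub>E Q) (\<lambda>e. avg (Y \<rightarrow>\<^sub>E Q) (\<lambda>t. f (glue I e t) * of_bool (D' t e))) \<le>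
          avg (I \<rightarrow>\<^sub>E Q) (\<lambda>e. \<beta> + \<mu> * avg (Y \<rightarrow>\<^sub>E Q) (\<lambda>t. of_bool (D' t e)))"
      proof (rule avg_mono)
        fix e assume e: "e \<in> I \<rightarrow>\<^sub>E Q"
        have "\<forall>t\<in>Y \<rightarrow>\<^sub>E Q. f (glue I e t) \<le> 1"
          using f(1) glue_in[OF e, of _ Y] unfolding IY(2) by blast
        moreover have "nonpos m Y (\<lambda>t. f (glue I e t))"
          by (rule nonpos_fibre[OF _ e IY(1)]) (use f(2) IY in simp)
        ultimately show "avg (Y \<rightarrow>\<^sub>E Q) (\<lambda>t. f (glue I e t) * of_bool (D' t e))
            \<le> \<beta> + \<mu> * avg (Y \<rightarrow>\<^sub>E Q) (\<lambda>t. of_bool (D' t e))"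
          by (rule n2[OF Y(1,5) a ins[OF e]])
      qed
      also have "\<dots> = \<beta> + \<mu> * avg (I \<rightarrow>\<^sub>E Q) (\<lambda>e. avg (Y \<rightarrow>\<^sub>E Q) (\<lambda>t. of_bool (D' t e)))"
        using Y words_Q by (simp add: avg_add avg_cmult avg_const)
      also have "\<dots> \<le> \<beta> + \<mu> * ((1 - c) * avg (J \<rightarrow>\<^sub>E Q) (\<lambda>x. of_bool (D x)))"
      proof -
        have "c * avg (J \<rightarrow>\<^sub>E Q) (\<lambda>x. of_bool (D x)) \<le> c * 1"
          using c dens1 by (intro mult_left_mono) auto
        also have "c * 1 \<le> \<theta> / real (card Q) ^ N" by (simp add: c_def)
        finally show ?thesis
          using drop \<mu>(1) by (intro add_left_mono mult_left_mono) (auto simp: algebra_simps)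
      qed
      finally show ?thesis by (simp add: mult.assoc)
    qed
    then show ?thesis unfolding insensitive_bound_def by (intro exI[of _ "n1 + n2 + N"]) blast
  qed
  with c show ?thesis using that by blast
qed

text \<open>Starting from the trivial bound with \<open>\<mu> = 1\<close>, repeated improvement makes \<open>\<mu>\<close> arbitrarily
  small.\<close>

lemma insensitive_set_small:
  assumes "\<beta> > 0"
  shows "\<exists>n. \<forall>J a D f. finite J \<longrightarrow> n \<le> card J \<longrightarrow> a \<in> K \<longrightarrow>
     insensitive J a D \<longrightarrow> (\<forall>x\<in>J \<rightarrow>\<^sub>E Q. f x \<le> 1) \<longrightarrow> nonpos m J f \<longrightarrow>
     avg (J \<rightarrow>\<^sub>E Q) (\<lambda>x. f x * of_bool (D x)) \<le> \<beta>"
proof -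
  have half: "\<beta> / 2 > 0" using assms by simp
  obtain c where c: "0 < c" "c \<le> 1" and
    improve: "\<And>\<mu>. 0 \<le> \<mu> \<Longrightarrow> insensitive_bound m (\<beta> / 2) \<mu> \<Longrightarrow> insensitive_bound m (\<beta> / 2) (\<mu> * (1 - c))"
    using insensitive_bound_improve[OF half, of m] by blast
  have bound: "insensitive_bound m (\<beta> / 2) ((1 - c) ^ r)" for r
  proof (induction r)
    case 0
    have "avg (J \<rightarrow>\<^sub>E Q) (\<lambda>x. f x * of_bool (D x)) \<le> \<beta> / 2 + 1 * avg (J \<rightarrow>\<^sub>E Q) (\<lambda>x. of_bool (D x))"
      if "\<forall>x\<in>J \<rightarrow>\<^sub>E Q. f x \<le> 1" for J :: "nat set" and f D
      using avg_mono[of "J \<rightarrow>\<^sub>E Q" "\<lambda>x. f x * of_bool (D x)" "\<lambda>x. of_bool (D x)"] that half by force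
    then show ?case unfolding insensitive_bound_def by simp
  next
    case (Suc r)
    then show ?case using improve[of "(1 - c) ^ r"] c by (simp add: mult.commute)
  qed
  obtain r where r: "(1 - c) ^ r < \<beta> / 2" using real_arch_pow_inv[OF half, of "1 - c"] c by auto
  obtain n where n: "\<And>J a D f. finite J \<Longrightarrow> n \<le> card J \<Longrightarrow> a \<in> K \<Longrightarrow>
     insensitive J a D \<Longrightarrow> \<forall>x\<in>J \<rightarrow>\<^sub>E Q. f x \<le> 1 \<Longrightarrow> nonpos m J f \<Longrightarrow>
     avg (J \<rightarrow>\<^sub>E Q) (\<lambda>x. f x * of_bool (D x)) \<le> \<beta> / 2 + (1 - c) ^ r * avg (J \<rightarrow>\<^sub>E Q) (\<lambda>x. of_bool (D x))"
    using bound[of r] unfolding insensitive_bound_def by blast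
  have "(1 - c) ^ r * avg (J \<rightarrow>\<^sub>E Q) (\<lambda>x. of_bool (D x)) \<le> \<beta> / 2" if "finite J" for J :: "nat set" and D
  proof -
    have "(1 - c) ^ r * avg (J \<rightarrow>\<^sub>E Q) (\<lambda>x. of_bool (D x)) \<le> (1 - c) ^ r * 1"
      using c words_Q[of J] that by (intro mult_left_mono avg_le) auto
    then show ?thesis using r by linarith
  qed
  note small = this
  have "avg (J \<rightarrow>\<^sub>E Q) (\<lambda>x. f x * of_bool (D x)) \<le> \<beta>"
    if "finite J" "n \<le> card J" "a \<in> K" "insensitive J a D" "\<forall>x\<in>J \<rightarrow>\<^sub>E Q. f x \<le> 1" "nonpos m J f" for J a D f
    using n[OF that] small[OF that(1), of D] by linarith
  then show ?thesis by blast
qed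

text \<open>For one more insensitive set \<open>D b\<close>, the bound for the other sets holds on every subspace of a
  suitable dimension \<open>n1\<close>. So the function that is \<open>f\<close> on their intersection and 0 elsewhere, lowered
  by \<open>\<beta> / 2\<close>, is nonpositive on average on those subspaces, and the case of a single set applies to
  it and \<open>D b\<close>. The empty intersection is the insensitive set of all words.\<close>

lemma insensitive_intersection_small:
  assumes "finite R" "R \<subseteq> K" "\<beta> > 0"
  shows "\<exists>n. \<forall>J D f. finite J \<longrightarrow> n \<le> card J \<longrightarrow> (\<forall>a\<in>R. insensitive J a (D a)) \<longrightarrow>
     (\<forall>x\<in>J \<rightarrow>\<^sub>E Q. f x \<le> 1) \<longrightarrow> nonpos m J f \<longrightarrow>
     avg (J \<rightarrow>\<^sub>E Q) (\<lambda>x. f x * of_bool (\<forall>a\<in>R. D a x)) \<le> \<beta>"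
  using assms
proof (induction R arbitrary: \<beta> rule: finite_induct)
  case empty
  obtain a where "a \<in> K" using K by blast
  obtain n where n: "\<And>J a D f. finite J \<Longrightarrow> n \<le> card J \<Longrightarrow> a \<in> K \<Longrightarrow>
     insensitive J a D \<Longrightarrow> \<forall>x\<in>J \<rightarrow>\<^sub>E Q. f x \<le> 1 \<Longrightarrow> nonpos m J f \<Longrightarrow>
     avg (J \<rightarrow>\<^sub>E Q) (\<lambda>x. f x * of_bool (D x)) \<le> \<beta>"
    using insensitive_set_small[OF empty(2), of m] by blast
  have "avg (J \<rightarrow>\<^sub>E Q) f \<le> \<beta>"
    if "finite J" "n \<le> card J" "\<forall>x\<in>J \<rightarrow>\<^sub>E Q. f x \<le> 1" "nonpos m J f" for J f
    using n[OF that(1,2) \<open>a \<in> K\<close> insensitive_const[of _ _ True] that(3,4)] by simp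
  then show ?case by (intro exI[of _ n]) simp
next
  case (insert b R)
  have half: "\<beta> / 2 > 0" and b: "b \<in> K" "R \<subseteq> K" using insert by auto
  obtain n1 where n1: "\<And>J D f. finite J \<Longrightarrow> n1 \<le> card J \<Longrightarrow> \<forall>a\<in>R. insensitive J a (D a) \<Longrightarrow>
     \<forall>x\<in>J \<rightarrow>\<^sub>E Q. f x \<le> 1 \<Longrightarrow> nonpos m J f \<Longrightarrow>
     avg (J \<rightarrow>\<^sub>E Q) (\<lambda>x. f x * of_bool (\<forall>a\<in>R. D a x)) \<le> \<beta> / 2"
    using insert.IH[OF b(2) half] by blast
  obtain n where n: "\<And>J a D f. finite J \<Longrightarrow> n \<le> card J \<Longrightarrow> a \<in> K \<Longrightarrow>
     insensitive J a D \<Longrightarrow> \<forall>x\<in>J \<rightarrow>\<^sub>E Q. f x \<le> 1 \<Longrightarrow> nonpos n1 J f \<Longrightarrow>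
     avg (J \<rightarrow>\<^sub>E Q) (\<lambda>x. f x * of_bool (D x)) \<le> \<beta> / 2"
    using insensitive_set_small[OF half, of n1] by blast
  have "avg (J \<rightarrow>\<^sub>E Q) (\<lambda>x. f x * of_bool (\<forall>a\<in>insert b R. D a x)) \<le> \<beta>"
    if J: "finite J" "n \<le> card J" and D: "\<forall>a\<in>insert b R. insensitive J a (D a)"
      and f: "\<forall>x\<in>J \<rightarrow>\<^sub>E Q. f x \<le> 1" "nonpos m J f" for J D f
  proof -
    define g where "g x = f x * of_bool (\<forall>a\<in>R. D a x) - \<beta> / 2" for x
    have g1: "\<forall>x\<in>J \<rightarrow>\<^sub>E Q. g x \<le> 1"
    proof
      fix x assume "x \<in> J \<rightarrow>\<^sub>E Q"
      then have "f x \<le> 1" using f(1) by blast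
      then show "g x \<le> 1" using half by (cases "\<forall>a\<in>R. D a x") (simp_all add: g_def)
    qed
    have g2: "nonpos n1 J g" unfolding nonpos_def
    proof
      fix \<tau> assume \<tau>: "\<tau> \<in> patterns Q {..<n1} J"
      have "\<forall>x\<in>{..<n1} \<rightarrow>\<^sub>E Q. f (fill J \<tau> x) \<le> 1" using f(1) fill_pattern_in[OF \<tau>] by blast
      moreover have "\<forall>a\<in>R. insensitive {..<n1} a (\<lambda>x. D a (fill J \<tau> x))"
        using D insensitive_fill[OF _ \<tau>] by blast
      ultimately have "avg ({..<n1} \<rightarrow>\<^sub>E Q) (\<lambda>x. f (fill J \<tau> x) * of_bool (\<forall>a\<in>R. D a (fill J \<tau> x))) \<le> \<beta> / 2"
        using n1[of "{..<n1}" "\<lambda>a x. D a (fill J \<tau> x)" "\<lambda>x. f (fill J \<tau> x)"] nonpos_fill[OF f(2) \<tau>] by simp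
      then show "avg ({..<n1} \<rightarrow>\<^sub>E Q) (\<lambda>x. g (fill J \<tau> x)) \<le> 0"
        using words_Q[of "{..<n1}"] by (simp add: g_def avg_diff avg_const)
    qed
    have "avg (J \<rightarrow>\<^sub>E Q) (\<lambda>x. f x * of_bool (\<forall>a\<in>insert b R. D a x))
        \<le> avg (J \<rightarrow>\<^sub>E Q) (\<lambda>x. g x * of_bool (D b x) + \<beta> / 2)"
      using half by (intro avg_mono) (simp add: g_def)
    also have "\<dots> = avg (J \<rightarrow>\<^sub>E Q) (\<lambda>x. g x * of_bool (D b x)) + \<beta> / 2"
      using words_Q[of J] J by (simp add: avg_add avg_const)
    also have "\<dots> \<le> \<beta>" using n[OF J b(1) _ g1 g2, of "D b"] D by simp
    finally show ?thesis .
  qed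
  then show ?case by blast
qed

text \<open>The complement of an intersection is a disjoint union of intersections of insensitive sets, one
  for each possible first set that a word fails to belong to.\<close>

lemma insensitive_complement_small:
  assumes "finite R" "R \<subseteq> K" "\<beta> > 0"
  shows "\<exists>n. \<forall>J D f. finite J \<longrightarrow> n \<le> card J \<longrightarrow> (\<forall>a\<in>R. insensitive J a (D a)) \<longrightarrow>
     (\<forall>x\<in>J \<rightarrow>\<^sub>E Q. f x \<le> 1) \<longrightarrow> nonpos m J f \<longrightarrow>
     avg (J \<rightarrow>\<^sub>E Q) (\<lambda>x. f x * of_bool (\<not> (\<forall>a\<in>R. D a x))) \<le> \<beta>"
  using assms
proof (induction R arbitrary: \<beta> rule: finite_induct)
  case empty
  then show ?case by (simp add: avg_def)
next
  case (insert b R)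
  have half: "\<beta> / 2 > 0" and b: "b \<in> K" "R \<subseteq> K" "finite (insert b R)" "insert b R \<subseteq> K"
    using insert by auto
  obtain n1 where n1: "\<And>J D f. finite J \<Longrightarrow> n1 \<le> card J \<Longrightarrow> \<forall>a\<in>R. insensitive J a (D a) \<Longrightarrow>
     \<forall>x\<in>J \<rightarrow>\<^sub>E Q. f x \<le> 1 \<Longrightarrow> nonpos m J f \<Longrightarrow>
     avg (J \<rightarrow>\<^sub>E Q) (\<lambda>x. f x * of_bool (\<not> (\<forall>a\<in>R. D a x))) \<le> \<beta> / 2"
    using insert.IH[OF b(2) half] by blast
  obtain n2 where n2: "\<And>J D f. finite J \<Longrightarrow> n2 \<le> card J \<Longrightarrow> \<forall>a\<in>insert b R. insensitive J a (D a) \<Longrightarrow>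
     \<forall>x\<in>J \<rightarrow>\<^sub>E Q. f x \<le> 1 \<Longrightarrow> nonpos m J f \<Longrightarrow>
     avg (J \<rightarrow>\<^sub>E Q) (\<lambda>x. f x * of_bool (\<forall>a\<in>insert b R. D a x)) \<le> \<beta> / 2"
    using insensitive_intersection_small[OF b(3,4) half, of m] by blast
  have "avg (J \<rightarrow>\<^sub>E Q) (\<lambda>x. f x * of_bool (\<not> (\<forall>a\<in>insert b R. D a x))) \<le> \<beta>"
    if J: "finite J" "n1 + n2 \<le> card J" and D: "\<forall>a\<in>insert b R. insensitive J a (D a)"
      and f: "\<forall>x\<in>J \<rightarrow>\<^sub>E Q. f x \<le> 1" "nonpos m J f" for J D f
  proof -
    define D' where "D' a = (if a = b then \<lambda>x. \<not> D b x else D a)" for a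
    have "of_bool (\<not> (\<forall>a\<in>insert b R. D a x))
        = of_bool (\<not> (\<forall>a\<in>R. D a x)) + (of_bool (\<forall>a\<in>insert b R. D' a x) :: real)" for x
    proof -
      have "(\<forall>a\<in>R. D' a x) = (\<forall>a\<in>R. D a x)" using insert.hyps by (auto simp: D'_def)
      then show ?thesis by (simp add: D'_def)
    qed
    then have "avg (J \<rightarrow>\<^sub>E Q) (\<lambda>x. f x * of_bool (\<not> (\<forall>a\<in>insert b R. D a x)))
        = avg (J \<rightarrow>\<^sub>E Q) (\<lambda>x. f x * of_bool (\<not> (\<forall>a\<in>R. D a x)))
        + avg (J \<rightarrow>\<^sub>E Q) (\<lambda>x. f x * of_bool (\<forall>a\<in>insert b R. D' a x))"
      by (simp only: distrib_left avg_add)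
    moreover have "\<forall>a\<in>insert b R. insensitive J a (D' a)"
      using D insensitive_not by (auto simp: D'_def)
    ultimately show ?thesis
      using n1[OF J(1) _ _ f, of D] n2[OF J(1) _ _ f, of D'] J(2) D by fastforce
  qed
  then show ?case by blast
qed

section \<open>A line-free set avoids an intersection of insensitive sets\<close>

text \<open>The words on \<open>P\<close> that extend \<open>c\<close> form a subspace with coordinates \<open>I\<close>, on which each fibre of \<open>A\<close>
  at a word \<open>y\<close> on the remaining coordinates avoids an intersection of insensitive sets.\<close>

definition avoids_insensitive ::
    "real \<Rightarrow> nat \<Rightarrow> nat set \<Rightarrow> nat set \<Rightarrow> (nat \<Rightarrow> 'a) set \<Rightarrow> bool" where
  "avoids_insensitive \<theta> N P Y A \<longleftrightarrow> (\<exists>I\<subseteq>P. \<exists>c\<in>(P - I) \<rightarrow>\<^sub>E Q. \<exists>D. card I = N \<and>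
      (\<forall>a\<in>K. \<forall>y. insensitive I a (D a y)) \<and>
      (\<forall>v\<in>I \<rightarrow>\<^sub>E Q. \<forall>y\<in>Y \<rightarrow>\<^sub>E Q. (\<forall>a\<in>K. D a y v) \<longrightarrow> glue P (glue (P - I) c v) y \<notin> A) \<and>
      \<theta> \<le> avg (I \<rightarrow>\<^sub>E Q) (\<lambda>v. avg (Y \<rightarrow>\<^sub>E Q) (\<lambda>y. of_bool (\<forall>a\<in>K. D a y v))))"

text \<open>Let \<open>P\<close> consist of a small set \<open>B\<close> and a large set \<open>M\<close>. A random pattern \<open>t\<close> on \<open>M\<close>,
  whose entries are letters of \<open>K\<close> or variables from \<open>B\<close>, embeds the words \<open>u\<close> on \<open>B\<close> into
  those on \<open>P\<close> by \<open>u \<mapsto> glue B u (fill M t u)\<close>. For each pair of \<open>t\<close> and \<open>y\<close> for which enough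
  words \<open>u\<close> over \<open>K\<close> are mapped into the fibre of \<open>A\<close> at \<open>y\<close>, the theorem for \<open>K\<close> gives a
  line on \<open>B\<close>, and one line \<open>\<kappa>\<close> serves for a proportion \<open>\<theta>\<close> of the pairs. Its points \<open>L a\<close>
  with \<open>a \<in> K\<close> are mapped into the fibre, so \<open>L z\<close> is not. Now the coordinates of \<open>t\<close> in a
  large set \<open>I\<close> are restricted, by sampling, to one entry for each letter of \<open>Q\<close>, namely the
  letters of \<open>K\<close> and a wildcard \<open>b0\<close> of the line, which becomes \<open>z\<close> in \<open>L z\<close>. So \<open>t\<close> amounts
  to an arbitrary word \<open>v\<close> over \<open>Q\<close> on \<open>I\<close>, and the image of \<open>L a\<close> is obtained from that of
  \<open>L z\<close> by demoting \<open>z\<close> to \<open>a\<close> in \<open>v\<close>, together with changes outside \<open>I\<close> that do not depend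
  on \<open>v\<close>. Keeping \<open>B\<close> as part of the coordinates ensures that these images do form a line.\<close>

lemma correlation:
  assumes "d > 0"
  obtains \<theta> where "\<theta> > 0" and "\<And>M. \<exists>p. \<forall>P Y A. finite P \<longrightarrow> card P = p \<longrightarrow> finite Y \<longrightarrow> P \<inter> Y = {} \<longrightarrow>
    \<not> has_subspace Q 1 (P \<union> Y) A \<longrightarrow>
    (\<forall>w\<in>P \<rightarrow>\<^sub>E Q. d \<le> avg (Y \<rightarrow>\<^sub>E Q) (\<lambda>y. of_bool (glue P w y \<in> A))) \<longrightarrow>
    avoids_insensitive \<theta> M P Y A"
proof -
  have half: "d / 2 > 0" using assms by simp
  obtain m where m: "\<And>J A. finite J \<Longrightarrow> m \<le> card J \<Longrightarrow> A \<subseteq> J \<rightarrow>\<^sub>E K \<Longrightarrow>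
     d / 2 \<le> avg (J \<rightarrow>\<^sub>E K) (\<lambda>w. of_bool (w \<in> A)) \<Longrightarrow> has_subspace K 1 J A"
    using K_dense[OF half, of 1] unfolding density_forces_subspace_def by blast
  define b where "b = real ((card K + 1) ^ m)"
  define \<theta> where "\<theta> = d / (2 * b)"
  have "b > 0" by (simp add: b_def add_nonneg_pos)
  then have \<theta>: "\<theta> > 0" "\<theta> / 2 > 0" using assms by (simp_all add: \<theta>_def)
  have main: "\<exists>p. \<forall>P Y A. finite P \<longrightarrow> card P = p \<longrightarrow> finite Y \<longrightarrow> P \<inter> Y = {} \<longrightarrow>
    \<not> has_subspace Q 1 (P \<union> Y) A \<longrightarrow>
    (\<forall>w\<in>P \<rightarrow>\<^sub>E Q. d \<le> avg (Y \<rightarrow>\<^sub>E Q) (\<lambda>y. of_bool (glue P w y \<in> A))) \<longrightarrow>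
    avoids_insensitive (\<theta> / 2) N P Y A" for N
  proof -
    from sample_coordinates[OF \<theta>(2), of "card K + m" N]
    obtain n where n: "\<And>(J::nat set) (T::('a + nat) set) S f. finite J \<Longrightarrow> n \<le> card J \<Longrightarrow> finite T \<Longrightarrow>
      card T \<le> card K + m \<Longrightarrow> S \<subseteq> T \<Longrightarrow> S \<noteq> {} \<Longrightarrow> \<forall>t\<in>J \<rightarrow>\<^sub>E T. 0 \<le> f t \<and> f t \<le> 1 \<Longrightarrow>
      \<exists>I\<subseteq>J. card I = N \<and>
        avg (J \<rightarrow>\<^sub>E T) f - \<theta> / 2 \<le> avg ((J - I) \<rightarrow>\<^sub>E T) (\<lambda>t. avg (I \<rightarrow>\<^sub>E S) (\<lambda>e. f (glue (J - I) t e)))"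
      by blast
    have "avoids_insensitive (\<theta> / 2) N P Y A"
      if P: "finite P" "card P = m + n" and Y: "finite Y" "P \<inter> Y = {}"
        and free: "\<not> has_subspace Q 1 (P \<union> Y) A"
        and dense: "\<forall>w\<in>P \<rightarrow>\<^sub>E Q. d \<le> avg (Y \<rightarrow>\<^sub>E Q) (\<lambda>y. of_bool (glue P w y \<in> A))" for P Y A
    proof -
      obtain B where B: "B \<subseteq> P" "card B = m" "finite B"
        using obtain_subset_with_card_n[of m P] P by auto
      define M where "M = P - B"
      have M: "finite M" "n \<le> card M" "B \<inter> M = {}" "B \<union> M = P"
        using P B by (auto simp: M_def card_Diff_subset)
      define T where "T = K <+> B"
      have T: "finite T" "card T \<le> card K + m" "T \<noteq> {}" using K B by (auto simp: T_def card_Plus)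
      define R where "R u t y \<longleftrightarrow> glue P (glue B u (fill M t u)) y \<in> A" for u t y
      have word: "glue B u (fill M t u) \<in> P \<rightarrow>\<^sub>E Q" if "u \<in> B \<rightarrow>\<^sub>E Q" "t \<in> M \<rightarrow>\<^sub>E T" for u t
        using glue_in[OF that(1) fill_in[OF that(2)[unfolded T_def] Q(3) that(1)]] M(4) by simp
      have KQ: "B \<rightarrow>\<^sub>E K \<subseteq> B \<rightarrow>\<^sub>E Q" using PiE_mono[of B "\<lambda>_. K" "\<lambda>_. Q"] Q(3) by blast
      have fins: "finite (B \<rightarrow>\<^sub>E K)" "B \<rightarrow>\<^sub>E K \<noteq> {}" "finite (M \<rightarrow>\<^sub>E T)" "M \<rightarrow>\<^sub>E T \<noteq> {}"
        "finite (Y \<rightarrow>\<^sub>E Q)" "Y \<rightarrow>\<^sub>E Q \<noteq> {}"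
        using K B T M Y by (simp_all add: words_finite words_nonempty words_Q)
      obtain \<kappa> where \<kappa>: "\<kappa> \<in> patterns K {..<1} B" and many: "d / (2 * b) \<le>
        avg ((M \<rightarrow>\<^sub>E T) \<times> (Y \<rightarrow>\<^sub>E Q)) (\<lambda>ty. of_bool (\<forall>u\<in>fill B \<kappa> ` ({..<1} \<rightarrow>\<^sub>E K). R u (fst ty) (snd ty)))"
      proof (rule common_configuration[of "B \<rightarrow>\<^sub>E K" "(M \<rightarrow>\<^sub>E T) \<times> (Y \<rightarrow>\<^sub>E Q)" "patterns K {..<1} B" b d
          "\<lambda>u ty. R u (fst ty) (snd ty)" "\<lambda>\<kappa>. fill B \<kappa> ` ({..<1} \<rightarrow>\<^sub>E K)"])
        show "real (card (patterns K {..<1} B)) \<le> b"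
          using card_patterns_le[of K B 1] K B unfolding b_def by (simp flip: of_nat_power of_nat_add)
        show "d \<le> avg ((M \<rightarrow>\<^sub>E T) \<times> (Y \<rightarrow>\<^sub>E Q)) (\<lambda>ty. avg (B \<rightarrow>\<^sub>E K) (\<lambda>u. of_bool (R u (fst ty) (snd ty))))"
          unfolding avg_Times fst_conv snd_conv
        proof (rule avg_ge[OF fins(3,4)])
          fix t assume t: "t \<in> M \<rightarrow>\<^sub>E T"
          have "d \<le> avg (B \<rightarrow>\<^sub>E K) (\<lambda>u. avg (Y \<rightarrow>\<^sub>E Q) (\<lambda>y. of_bool (R u t y)))"
            unfolding R_def by (rule avg_ge[OF fins(1,2)]) (use dense word[OF _ t] KQ in blast)
          then show "d \<le> avg (Y \<rightarrow>\<^sub>E Q) (\<lambda>y. avg (B \<rightarrow>\<^sub>E K) (\<lambda>u. of_bool (R u t y)))"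
            by (subst avg_swap)
        qed
        show "\<exists>\<kappa>\<in>patterns K {..<1} B. fill B \<kappa> ` ({..<1} \<rightarrow>\<^sub>E K) \<subseteq> A'"
          if "A' \<subseteq> B \<rightarrow>\<^sub>E K" "d / 2 \<le> avg (B \<rightarrow>\<^sub>E K) (\<lambda>x. of_bool (x \<in> A'))" for A'
          using m[of B A'] that B unfolding has_subspace_def by auto
      qed (use K B fins \<open>d > 0\<close> in \<open>auto simp: patterns_finite\<close>)
      define L where "L a = fill B \<kappa> (\<lambda>i\<in>{..<1}. a)" for a
      have \<kappa>Q: "\<kappa> \<in> patterns Q {..<1} B" using \<kappa> patterns_mono[OF Q(3)] by blast
      have L_in: "L a \<in> B \<rightarrow>\<^sub>E Q" if "a \<in> Q" for a
        unfolding L_def by (intro fill_pattern_in[OF \<kappa>Q] constant_word_in that)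
      obtain b0 where b0: "b0 \<in> B" "\<kappa> b0 = Inr 0" using pattern_variable[OF \<kappa>, of 0] by auto
      have L_b0: "L a b0 = a" for a using b0 by (simp add: L_def fill_def)
      define F where "F t = avg (Y \<rightarrow>\<^sub>E Q) (\<lambda>y. of_bool (\<forall>a\<in>K. R (L a) t y))" for t
      have F01: "0 \<le> F t \<and> F t \<le> 1" for t
        unfolding F_def by (intro conjI avg_nonneg avg_le fins) auto
      have "\<theta> \<le> avg (M \<rightarrow>\<^sub>E T) F"
      proof -
        have "\<theta> \<le> avg ((M \<rightarrow>\<^sub>E T) \<times> (Y \<rightarrow>\<^sub>E Q)) (\<lambda>ty. of_bool (\<forall>a\<in>K. R (L a) (fst ty) (snd ty)))"
        proof (rule order_trans[OF many[folded \<theta>_def] avg_mono])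
          fix ty :: "(nat \<Rightarrow> 'a + nat) \<times> (nat \<Rightarrow> 'a)"
          have "L a \<in> fill B \<kappa> ` ({..<1} \<rightarrow>\<^sub>E K)" if "a \<in> K" for a
            unfolding L_def by (intro imageI constant_word_in that)
          then have "(\<forall>u\<in>fill B \<kappa> ` ({..<1} \<rightarrow>\<^sub>E K). R u (fst ty) (snd ty)) \<longrightarrow>
              (\<forall>a\<in>K. R (L a) (fst ty) (snd ty))" by blast
          then show "of_bool (\<forall>u\<in>fill B \<kappa> ` ({..<1} \<rightarrow>\<^sub>E K). R u (fst ty) (snd ty))
            \<le> (of_bool (\<forall>a\<in>K. R (L a) (fst ty) (snd ty)) :: real)"
            by (simp only: of_bool_def split: if_split) simp
        qed
        then show ?thesis unfolding avg_Times F_def by simp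
      qed
      \<comment> \<open>Substituting \<open>L a\<close> into the entry \<open>r c\<close> gives \<open>demote a c\<close>.\<close>
      define r where "r c = (if c = z then Inr b0 else Inl c)" for c
      have r: "inj_on r Q" "r ` Q \<subseteq> T" "r ` Q \<noteq> {}"
        using Q b0 by (auto simp: r_def inj_on_def T_def Q_def)
      have "\<forall>t\<in>M \<rightarrow>\<^sub>E T. 0 \<le> F t \<and> F t \<le> 1" using F01 by blast
      from n[OF M(1,2) T(1,2) r(2,3) this]
      obtain I where I: "I \<subseteq> M" "card I = N" and
        samp: "avg (M \<rightarrow>\<^sub>E T) F - \<theta> / 2 \<le> avg ((M - I) \<rightarrow>\<^sub>E T) (\<lambda>t. avg (I \<rightarrow>\<^sub>E r ` Q) (\<lambda>e. F (glue (M - I) t e)))"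
        by blast
      have MI: "finite ((M - I) \<rightarrow>\<^sub>E T)" "(M - I) \<rightarrow>\<^sub>E T \<noteq> {}" using M T by (simp_all add: words_finite words_nonempty)
      have "\<theta> / 2 \<le> avg ((M - I) \<rightarrow>\<^sub>E T) (\<lambda>t. avg (I \<rightarrow>\<^sub>E r ` Q) (\<lambda>e. F (glue (M - I) t e)))"
        using samp \<open>\<theta> \<le> avg (M \<rightarrow>\<^sub>E T) F\<close> by linarith
      then obtain t0 where t0: "t0 \<in> (M - I) \<rightarrow>\<^sub>E T"
        and t0_dense: "\<theta> / 2 \<le> avg (I \<rightarrow>\<^sub>E r ` Q) (\<lambda>e. F (glue (M - I) t0 e))"
        using avg_ge_witness[OF MI] by blast
      define \<tau> where "\<tau> v = glue (M - I) t0 (\<lambda>i\<in>I. r (v i))" for v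
      have MIM: "(M - I) \<union> I = M" using I by blast
      have \<tau>_in: "\<tau> v \<in> M \<rightarrow>\<^sub>E T" if v: "v \<in> I \<rightarrow>\<^sub>E Q" for v
      proof -
        have "(\<lambda>i\<in>I. r (v i)) \<in> I \<rightarrow>\<^sub>E T" using PiE_mem[OF v] r(2) by (auto simp: restrict_PiE_iff)
        from glue_in[OF t0 this] show ?thesis unfolding \<tau>_def MIM .
      qed
      define D where "D a y v = R (L a) (\<tau> v) y" for a y v
      have dense_D: "\<theta> / 2 \<le> avg (I \<rightarrow>\<^sub>E Q) (\<lambda>v. avg (Y \<rightarrow>\<^sub>E Q) (\<lambda>y. of_bool (\<forall>a\<in>K. D a y v)))"
        using t0_dense unfolding avg_bij[OF bij_betw_map_words[OF r(1)]] F_def D_def \<tau>_def .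
      have fill_\<tau>: "fill M (\<tau> v) (L a) = glue (M - I) (fill (M - I) t0 (L a)) (\<lambda>i\<in>I. demote a (v i))" for a v
      proof -
        have "fill I (\<lambda>i\<in>I. r (v i)) (L a) = (\<lambda>i\<in>I. demote a (v i))"
          by (auto simp: fill_def fun_eq_iff r_def demote_def L_b0)
        then show ?thesis using fill_glue[of "M - I" I t0 _ "L a"] unfolding \<tau>_def MIM by simp
      qed
      have ins: "insensitive I a (D a y)" for a y
        unfolding insensitive_def
      proof (intro ballI impI)
        fix v v' assume eq: "\<forall>i\<in>I. demote a (v i) = demote a (v' i)" and D: "D a y v"
        have "(\<lambda>i\<in>I. demote a (v i)) = (\<lambda>i\<in>I. demote a (v' i))" using eq by (auto simp: fun_eq_iff)
        then show "D a y v'" using D unfolding D_def R_def fill_\<tau> by simp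
      qed
      define c where "c = glue B (L z) (fill (M - I) t0 (L z))"
      have PI: "P - I = B \<union> (M - I)" using M I by blast
      have c_in: "c \<in> (P - I) \<rightarrow>\<^sub>E Q" unfolding c_def PI
        using t0 by (intro glue_in fill_in[of t0 _ K B Q] L_in Q) (simp add: T_def)
      have disjoint: "glue P (glue (P - I) c v) y \<notin> A"
        if v: "v \<in> I \<rightarrow>\<^sub>E Q" and y: "y \<in> Y \<rightarrow>\<^sub>E Q" and all: "\<forall>a\<in>K. D a y v" for v y
      proof
        assume in_A: "glue P (glue (P - I) c v) y \<in> A"
        define \<rho> where "\<rho> = glue P (glue B \<kappa> (compose_pattern M (\<tau> v) \<kappa>)) (constant_pattern Y y)"
        have "compose_pattern M (\<tau> v) \<kappa> \<in> M \<rightarrow>\<^sub>E (K <+> {..<1})"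
          by (rule compose_pattern_word[OF \<tau>_in[OF v, unfolded T_def] pattern_word[OF \<kappa>]])
        from glue_in[OF pattern_word[OF \<kappa>] this]
        have "glue B \<kappa> (compose_pattern M (\<tau> v) \<kappa>) \<in> P \<rightarrow>\<^sub>E (K <+> {..<1})" unfolding M(4) .
        then have "glue B \<kappa> (compose_pattern M (\<tau> v) \<kappa>) \<in> P \<rightarrow>\<^sub>E (Q <+> {..<1})"
          using PiE_mono[of P "\<lambda>_. K <+> {..<1}" "\<lambda>_. Q <+> {..<1::nat}"] Q(3) by blast
        moreover have "constant_pattern Y y \<in> Y \<rightarrow>\<^sub>E (Q <+> {..<1})"
          using PiE_mem[OF y] unfolding constant_pattern_def restrict_PiE_iff by blast
        ultimately have "\<rho> \<in> (P \<union> Y) \<rightarrow>\<^sub>E (Q <+> {..<1})" unfolding \<rho>_def by (rule glue_in)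
        moreover have "\<rho> b0 = Inr 0" "b0 \<in> P \<union> Y" using b0 B by (auto simp: \<rho>_def glue_def)
        ultimately have "\<rho> \<in> patterns Q {..<1} (P \<union> Y)" by (auto simp: patterns_def)
        moreover have "fill (P \<union> Y) \<rho> x \<in> A" if x: "x \<in> {..<1} \<rightarrow>\<^sub>E Q" for x
        proof -
          have "fill B \<kappa> x = L (x 0)" unfolding L_def
            by (rule fill_cong[OF pattern_word[OF \<kappa>]]) simp
          then have eq: "fill (P \<union> Y) \<rho> x = glue P (glue B (L (x 0)) (fill M (\<tau> v) (L (x 0)))) y"
            using fill_glue[of B M \<kappa> _ x] fill_compose[OF \<tau>_in[OF v, unfolded T_def], of \<kappa> x]
            unfolding \<rho>_def fill_glue M(4) by (simp add: fill_constant_pattern[OF y])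
          have "x 0 \<in> Q" using PiE_mem[OF x] by simp
          then consider "x 0 \<in> K" | "x 0 = z" by (auto simp: Q_def)
          then show ?thesis
          proof cases
            case 1
            then show ?thesis using all unfolding eq D_def R_def by blast
          next
            case 2
            have "(\<lambda>i\<in>I. demote z (v i)) = v"
              using PiE_arb[OF v] by (auto simp: demote_def fun_eq_iff)
            then have "glue B (L z) (fill M (\<tau> v) (L z)) = glue (P - I) c v"
              unfolding fill_\<tau> c_def PI by (auto simp: glue_def fun_eq_iff)
            then show ?thesis using in_A unfolding eq 2 by simp
          qed
        qed
        ultimately show False using free unfolding has_subspace_def by blast
      qed
      have "I \<subseteq> P" using I M by blast
      then show ?thesis using I(2) c_in ins disjoint dense_D unfolding avoids_insensitive_def
        by (intro exI[of _ I] exI[of _ D] conjI bexI[of _ c]) blast+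
    qed
    then show ?thesis by (intro exI[of _ "m + n"]) blast
  qed
  show ?thesis by (rule that[OF \<theta>(2) main])
qed

end

section \<open>The critical density\<close>

lemma critical_density:
  assumes "finite S" "S \<noteq> {}" "\<delta> > 0" "\<not> density_forces_subspace S m \<delta>"
  obtains d where "d > 0" "\<And>\<epsilon>. \<epsilon> > 0 \<Longrightarrow> density_forces_subspace S m (d + \<epsilon>)"
    "\<And>\<epsilon>. \<epsilon> > 0 \<Longrightarrow> \<not> density_forces_subspace S m (d - \<epsilon>)"
proof -
  define X where "X = {\<epsilon>. density_forces_subspace S m \<epsilon>}"
  have lower: "\<delta> \<le> \<epsilon>" if "\<epsilon> \<in> X" for \<epsilon>
    using that assms(4) density_forces_subspace_mono[of S m \<epsilon> \<delta>] by (force simp: X_def)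
  \<comment> \<open>Density 2 is never attained, so it forces subspaces vacuously and \<open>X\<close> is nonempty.\<close>
  have "\<not> 2 \<le> avg (J \<rightarrow>\<^sub>E S) (\<lambda>w. of_bool (w \<in> A))" if "finite J" for J :: "nat set" and A
  proof -
    have "avg (J \<rightarrow>\<^sub>E S) (\<lambda>w. of_bool (w \<in> A)) \<le> 1"
      by (rule avg_le) (use assms that in \<open>simp_all add: words_finite words_nonempty\<close>)
    then show ?thesis by simp
  qed
  then have "2 \<in> X" unfolding X_def density_forces_subspace_def by blast
  then have ne: "X \<noteq> {}" by blast
  have bdd: "bdd_below X" using lower by (rule bdd_belowI)
  show ?thesis
  proof (rule that[of "Inf X"])
    have "\<delta> \<le> Inf X" using cInf_greatest[OF ne lower] .
    then show "0 < Inf X" using assms(3) by linarith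
  next
    fix \<epsilon> :: real assume "\<epsilon> > 0"
    then obtain \<epsilon>' where "\<epsilon>' \<in> X" "\<epsilon>' < Inf X + \<epsilon>" using cInf_lessD[OF ne, of "Inf X + \<epsilon>"] by auto
    then show "density_forces_subspace S m (Inf X + \<epsilon>)"
      using density_forces_subspace_mono[of S m \<epsilon>'] by (simp add: X_def)
  next
    fix \<epsilon> :: real assume "\<epsilon> > 0"
    then show "\<not> density_forces_subspace S m (Inf X - \<epsilon>)"
      using cInf_lower[OF _ bdd, of "Inf X - \<epsilon>"] by (auto simp: X_def)
  qed
qed

context new_letter begin

text \<open>The complement of the intersection carries all of the set \<open>A\<close>, of density about \<open>d\<close>, on a
  proportion at most \<open>1 - \<theta>\<close> of the words. So the indicator of \<open>A\<close> minus \<open>d + \<xi>\<close>, averaged over the words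
  in the complement and counted as 0 elsewhere, gives about \<open>d * \<theta>\<close> or more. But it is at most \<open>\<xi>\<close> by
  \<open>insensitive_complement_small\<close>, since \<open>A\<close> has density at most \<open>d + \<xi>\<close> on every subspace of
  dimension \<open>m\<close>, being line-free.\<close>

lemma density_forces_line:
  assumes "\<delta> > 0"
  shows "density_forces_subspace Q 1 \<delta>"
proof (rule ccontr)
  assume "\<not> density_forces_subspace Q 1 \<delta>"
  then obtain d where d: "d > 0" and above: "\<And>\<epsilon>. \<epsilon> > 0 \<Longrightarrow> density_forces_subspace Q 1 (d + \<epsilon>)"
    and below: "\<And>\<epsilon>. \<epsilon> > 0 \<Longrightarrow> \<not> density_forces_subspace Q 1 (d - \<epsilon>)"
    using critical_density[OF Q(1,2) assms] by blast
  have "d / 2 > 0" using d by simp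
  obtain \<theta> where \<theta>: "\<theta> > 0" and corr: "\<And>M. \<exists>p. \<forall>P Y A. finite P \<longrightarrow> card P = p \<longrightarrow> finite Y \<longrightarrow>
    P \<inter> Y = {} \<longrightarrow> \<not> has_subspace Q 1 (P \<union> Y) A \<longrightarrow>
    (\<forall>w\<in>P \<rightarrow>\<^sub>E Q. d / 2 \<le> avg (Y \<rightarrow>\<^sub>E Q) (\<lambda>y. of_bool (glue P w y \<in> A))) \<longrightarrow>
    avoids_insensitive \<theta> M P Y A"
  proof (rule correlation[OF \<open>d / 2 > 0\<close>], goal_cases)
    case (1 \<theta>)
    show ?case by (rule 1(1)[OF 1(2,3)])
  qed
  \<comment> \<open>The final estimate reads \<open>d * \<theta> \<le> 3 * \<xi>\<close>, and fibres of density \<open>d - \<xi> \<ge> d / 2\<close> are needed.\<close>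
  define \<xi> where "\<xi> = min (d * \<theta> / 4) (d / 2)"
  have \<xi>: "\<xi> > 0" "\<xi> \<le> d / 2" "\<xi> \<le> d * \<theta> / 4" using d \<theta> by (simp_all add: \<xi>_def)
  obtain m where m: "\<And>J A. finite J \<Longrightarrow> m \<le> card J \<Longrightarrow> A \<subseteq> J \<rightarrow>\<^sub>E Q \<Longrightarrow>
     d + \<xi> \<le> avg (J \<rightarrow>\<^sub>E Q) (\<lambda>w. of_bool (w \<in> A)) \<Longrightarrow> has_subspace Q 1 J A"
    using above[OF \<xi>(1)] unfolding density_forces_subspace_def by blast
  obtain M where M: "\<And>J D f. finite J \<Longrightarrow> M \<le> card J \<Longrightarrow> \<forall>a\<in>K. insensitive J a (D a) \<Longrightarrow>
     \<forall>x\<in>J \<rightarrow>\<^sub>E Q. f x \<le> 1 \<Longrightarrow> nonpos m J f \<Longrightarrow>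
     avg (J \<rightarrow>\<^sub>E Q) (\<lambda>x. f x * of_bool (\<not> (\<forall>a\<in>K. D a x))) \<le> \<xi>"
    using insensitive_complement_small[OF K(1) order_refl \<xi>(1), of m] by blast
  obtain p where p: "\<And>P Y A. finite P \<Longrightarrow> card P = p \<Longrightarrow> finite Y \<Longrightarrow>
    P \<inter> Y = {} \<Longrightarrow> \<not> has_subspace Q 1 (P \<union> Y) A \<Longrightarrow>
    \<forall>w\<in>P \<rightarrow>\<^sub>E Q. d / 2 \<le> avg (Y \<rightarrow>\<^sub>E Q) (\<lambda>y. of_bool (glue P w y \<in> A)) \<Longrightarrow>
    avoids_insensitive \<theta> M P Y A"
    using corr[of M] by blast
  define N where "N = real (card Q ^ p)"
  have "0 < card Q" using Q by (simp add: card_gt_0_iff)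
  then have N: "N > 0" by (simp add: N_def)
  \<comment> \<open>\<open>N\<close> is the number of words on \<open>P\<close>. If all fibres have density at most
    \<open>d + \<zeta>\<close>, one of density below \<open>d - \<xi>\<close> would bring the average below \<open>d + \<zeta> - \<xi> / N = d - \<zeta>\<close>.\<close>
  define \<zeta> where "\<zeta> = \<xi> / (2 * N)"
  have \<zeta>: "\<zeta> > 0" using \<xi> N by (simp add: \<zeta>_def)
  obtain n where n: "\<And>J A. finite J \<Longrightarrow> n \<le> card J \<Longrightarrow> A \<subseteq> J \<rightarrow>\<^sub>E Q \<Longrightarrow>
     d + \<zeta> \<le> avg (J \<rightarrow>\<^sub>E Q) (\<lambda>w. of_bool (w \<in> A)) \<Longrightarrow> has_subspace Q 1 J A"
    using above[OF \<zeta>] unfolding density_forces_subspace_def by blast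
  obtain J A where J: "finite J" "p + n \<le> card J" and A: "A \<subseteq> J \<rightarrow>\<^sub>E Q"
    and dense: "d - \<zeta> \<le> avg (J \<rightarrow>\<^sub>E Q) (\<lambda>w. of_bool (w \<in> A))" and free: "\<not> has_subspace Q 1 J A"
  proof -
    from below[OF \<zeta>] have "\<exists>J A. finite J \<and> p + n \<le> card J \<and> A \<subseteq> J \<rightarrow>\<^sub>E Q \<and>
       d - \<zeta> \<le> avg (J \<rightarrow>\<^sub>E Q) (\<lambda>w. of_bool (w \<in> A)) \<and> \<not> has_subspace Q 1 J A"
      unfolding density_forces_subspace_def not_ex not_all not_imp by (rule spec)
    then show ?thesis using that by (elim exE conjE)
  qed
  obtain P where P: "P \<subseteq> J" "card P = p" "finite P"
    using obtain_subset_with_card_n[of p J] J by auto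
  define Y where "Y = J - P"
  have Y: "finite Y" "n \<le> card Y" "P \<inter> Y = {}" "P \<union> Y = J"
    using J P by (auto simp: Y_def card_Diff_subset)
  have WY: "finite (Y \<rightarrow>\<^sub>E Q)" "Y \<rightarrow>\<^sub>E Q \<noteq> {}" using Y by (simp_all add: words_Q)
  define h where "h w = avg (Y \<rightarrow>\<^sub>E Q) (\<lambda>y. of_bool (glue P w y \<in> A))" for w
  have h_upper: "h w \<le> d + \<zeta>" if w: "w \<in> P \<rightarrow>\<^sub>E Q" for w
  proof (rule ccontr)
    assume "\<not> h w \<le> d + \<zeta>"
    then have "d + \<zeta> \<le> avg (Y \<rightarrow>\<^sub>E Q) (\<lambda>y. of_bool (y \<in> {y \<in> Y \<rightarrow>\<^sub>E Q. glue P w y \<in> A}))"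
      by (simp add: h_def cong: avg_cong)
    then have "has_subspace Q 1 Y {y \<in> Y \<rightarrow>\<^sub>E Q. glue P w y \<in> A}" by (intro n Y) auto
    then have "has_subspace Q 1 (P \<union> Y) A" by (rule has_subspace_fibre[OF w Y(3)])
    then show False using free Y(4) by simp
  qed
  have h_avg: "d - \<zeta> \<le> avg (P \<rightarrow>\<^sub>E Q) h"
    using dense avg_glue[OF Y(3), of Q] unfolding Y(4) h_def by simp
  have h_lower: "d - \<xi> \<le> h w" if w: "w \<in> P \<rightarrow>\<^sub>E Q" for w
  proof -
    have "real (card (P \<rightarrow>\<^sub>E Q)) = N" using P by (simp add: card_PiE N_def)
    then have "d - \<zeta> \<le> d + \<zeta> - (d + \<zeta> - h w) / N"
      using h_avg avg_le_deficit[of "P \<rightarrow>\<^sub>E Q" w h "d + \<zeta>", OF words_Q(1)[OF P(3)] w h_upper] by simp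
    then have "d + \<zeta> - h w \<le> 2 * \<zeta> * N" using N by (simp add: field_simps)
    also have "\<dots> = \<xi>" using N by (simp add: \<zeta>_def)
    finally show ?thesis using \<zeta> by linarith
  qed
  have h_half: "\<forall>w\<in>P \<rightarrow>\<^sub>E Q. d / 2 \<le> avg (Y \<rightarrow>\<^sub>E Q) (\<lambda>y. of_bool (glue P w y \<in> A))"
  proof
    fix w assume "w \<in> P \<rightarrow>\<^sub>E Q"
    then show "d / 2 \<le> avg (Y \<rightarrow>\<^sub>E Q) (\<lambda>y. of_bool (glue P w y \<in> A))"
      using h_lower[of w] \<xi>(2) unfolding h_def by linarith
  qed
  have "\<not> has_subspace Q 1 (P \<union> Y) A" using free Y(4) by simp
  from p[OF P(3,2) Y(1,3) this h_half]
  obtain I c D where I: "I \<subseteq> P" "card I = M" and c: "c \<in> (P - I) \<rightarrow>\<^sub>E Q"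
    and ins: "\<forall>a\<in>K. \<forall>y. insensitive I a (D a y)"
    and disjoint: "\<forall>v\<in>I \<rightarrow>\<^sub>E Q. \<forall>y\<in>Y \<rightarrow>\<^sub>E Q. (\<forall>a\<in>K. D a y v) \<longrightarrow> glue P (glue (P - I) c v) y \<notin> A"
    and dense_D: "\<theta> \<le> avg (I \<rightarrow>\<^sub>E Q) (\<lambda>v. avg (Y \<rightarrow>\<^sub>E Q) (\<lambda>y. of_bool (\<forall>a\<in>K. D a y v)))"
    unfolding avoids_insensitive_def by (elim exE bexE conjE) (rule that)
  have fI: "finite I" using I P finite_subset by blast
  have WI: "finite (I \<rightarrow>\<^sub>E Q)" "I \<rightarrow>\<^sub>E Q \<noteq> {}" using fI by (simp_all add: words_Q)
  have PI: "(P - I) \<inter> I = {}" "(P - I) \<union> I = P" using I by auto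
  define A' where "A' y v \<longleftrightarrow> glue P (glue (P - I) c v) y \<in> A" for y v
  define f where "f y v = of_bool (A' y v) - (d + \<xi>)" for y v
  have word: "glue (P - I) c v \<in> P \<rightarrow>\<^sub>E Q" if "v \<in> I \<rightarrow>\<^sub>E Q" for v
    using glue_in[OF c that] unfolding PI(2) .
  have f1: "\<forall>v\<in>I \<rightarrow>\<^sub>E Q. f y v \<le> 1" for y using d \<xi> by (simp add: f_def)
  have f2: "nonpos m I (f y)" if y: "y \<in> Y \<rightarrow>\<^sub>E Q" for y
    unfolding nonpos_def
  proof (rule ballI, rule ccontr)
    fix \<tau> assume \<tau>: "\<tau> \<in> patterns Q {..<m} I" and neg: "\<not> avg ({..<m} \<rightarrow>\<^sub>E Q) (\<lambda>x. f y (fill I \<tau> x)) \<le> 0"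
    let ?V = "{w \<in> P \<rightarrow>\<^sub>E Q. glue Y y w \<in> A}"
    let ?U = "{v \<in> I \<rightarrow>\<^sub>E Q. glue (P - I) c v \<in> ?V}"
    let ?T = "{x \<in> {..<m} \<rightarrow>\<^sub>E Q. fill I \<tau> x \<in> ?U}"
    have U: "v \<in> ?U \<longleftrightarrow> A' y v" if v: "v \<in> I \<rightarrow>\<^sub>E Q" for v
      using v word[OF v] glue_commute[OF word[OF v] y Y(3)] by (simp add: A'_def)
    have "avg ({..<m} \<rightarrow>\<^sub>E Q) (\<lambda>x. f y (fill I \<tau> x))
        = avg ({..<m} \<rightarrow>\<^sub>E Q) (\<lambda>x. of_bool (x \<in> ?T) - (d + \<xi>))"
    proof (rule avg_cong)
      fix x assume x: "x \<in> {..<m} \<rightarrow>\<^sub>E Q"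
      have "x \<in> ?T \<longleftrightarrow> A' y (fill I \<tau> x)" using U[OF fill_pattern_in[OF \<tau> x]] x by simp
      then show "f y (fill I \<tau> x) = of_bool (x \<in> ?T) - (d + \<xi>)" unfolding f_def by simp
    qed
    also have "\<dots> = avg ({..<m} \<rightarrow>\<^sub>E Q) (\<lambda>x. of_bool (x \<in> ?T)) - (d + \<xi>)"
      using words_Q[of "{..<m}"] by (simp only: avg_diff avg_const finite_lessThan not_False_eq_True)
    finally have "d + \<xi> \<le> avg ({..<m} \<rightarrow>\<^sub>E Q) (\<lambda>x. of_bool (x \<in> ?T))" using neg by linarith
    then have "has_subspace Q 1 {..<m} ?T" by (intro m) auto
    from has_subspace_pullback[OF \<tau> this] have "has_subspace Q 1 I ?U" .
    from has_subspace_fibre[OF c PI(1) this] have "has_subspace Q 1 P ?V" unfolding PI(2) .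
    from has_subspace_fibre[OF y _ this] have "has_subspace Q 1 (Y \<union> P) A" using Y(3) by blast
    then show False using free Y(4) by (simp add: Un_commute)
  qed
  have "avg (Y \<rightarrow>\<^sub>E Q) (\<lambda>y. avg (I \<rightarrow>\<^sub>E Q) (\<lambda>v. f y v * of_bool (\<not> (\<forall>a\<in>K. D a y v)))) \<le> \<xi>"
    by (rule avg_le[OF WY]) (rule M[OF fI _ _ f1 f2], use I ins in auto)
  moreover have "avg (Y \<rightarrow>\<^sub>E Q) (\<lambda>y. avg (I \<rightarrow>\<^sub>E Q) (\<lambda>v. f y v * of_bool (\<not> (\<forall>a\<in>K. D a y v))))
    = avg (Y \<rightarrow>\<^sub>E Q) (\<lambda>y. avg (I \<rightarrow>\<^sub>E Q) (\<lambda>v. of_bool (A' y v) - (d + \<xi>) + (d + \<xi>) * of_bool (\<forall>a\<in>K. D a y v)))"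
    using disjoint by (intro avg_cong) (auto simp: f_def A'_def)
  moreover have "\<dots> = avg (Y \<rightarrow>\<^sub>E Q) (\<lambda>y. avg (I \<rightarrow>\<^sub>E Q) (\<lambda>v. of_bool (A' y v))) - (d + \<xi>)
      + (d + \<xi>) * avg (Y \<rightarrow>\<^sub>E Q) (\<lambda>y. avg (I \<rightarrow>\<^sub>E Q) (\<lambda>v. of_bool (\<forall>a\<in>K. D a y v)))"
    by (simp only: avg_add avg_diff avg_cmult avg_const[OF WI] avg_const[OF WY])
  moreover have "d - \<xi> \<le> avg (Y \<rightarrow>\<^sub>E Q) (\<lambda>y. avg (I \<rightarrow>\<^sub>E Q) (\<lambda>v. of_bool (A' y v)))"
  proof (subst avg_swap, rule avg_ge[OF WI])
    fix v assume "v \<in> I \<rightarrow>\<^sub>E Q"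
    from h_lower[OF word[OF this]] show "d - \<xi> \<le> avg (Y \<rightarrow>\<^sub>E Q) (\<lambda>y. of_bool (A' y v))"
      unfolding h_def A'_def .
  qed
  moreover have "d * \<theta> \<le> (d + \<xi>) * avg (Y \<rightarrow>\<^sub>E Q) (\<lambda>y. avg (I \<rightarrow>\<^sub>E Q) (\<lambda>v. of_bool (\<forall>a\<in>K. D a y v)))"
    using dense_D \<theta> d \<xi>(1) by (subst avg_swap) (intro mult_mono, auto)
  ultimately have "d * \<theta> \<le> 3 * \<xi>" by linarith
  then show False using \<xi>(3) mult_pos_pos[OF d \<theta>] by linarith
qed

end

theorem density_hales_jewett:
  fixes S :: "'a set"
  assumes "finite S" "S \<noteq> {}" "\<delta> > 0"
  shows "density_forces_subspace S 1 \<delta>"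
  using assms
proof (induction S arbitrary: \<delta> rule: finite_ne_induct)
  case (singleton a)
  have line: "has_subspace {a} 1 J A"
    if J: "1 \<le> card J" and A: "A \<subseteq> J \<rightarrow>\<^sub>E {a}" and dense: "\<delta> \<le> avg (J \<rightarrow>\<^sub>E {a}) (\<lambda>w. of_bool (w \<in> A))" for J A
  proof -
    have "A \<noteq> {}" using dense singleton by (auto simp: avg_def)
    then obtain w where "w \<in> A" by blast
    then have w: "w \<in> J \<rightarrow>\<^sub>E {a}" by (rule subsetD[OF A])
    have "J \<noteq> {}" using J by auto
    then have \<tau>: "(\<lambda>j\<in>J. Inr 0) \<in> patterns {a} {..<1} J" by (auto simp: patterns_def)
    have "fill J (\<lambda>j\<in>J. Inr 0) x \<in> A" if "x \<in> {..<1} \<rightarrow>\<^sub>E {a}" for x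
    proof -
      have x: "fill J (\<lambda>j\<in>J. Inr 0) x \<in> J \<rightarrow>\<^sub>E {a}" by (rule fill_pattern_in[OF \<tau> that])
      have "fill J (\<lambda>j\<in>J. Inr 0) x = w"
        by (rule PiE_ext[OF x w]) (use PiE_mem[OF x] PiE_mem[OF w] in blast)
      then show ?thesis using \<open>w \<in> A\<close> by simp
    qed
    then show ?thesis using \<tau> unfolding has_subspace_def by blast
  qed
  show ?case unfolding density_forces_subspace_def
    by (intro exI[of _ 1] allI impI) (rule line)
next
  case (insert z K)
  interpret new_letter K z
  proof
    show "density_forces_subspace K m \<epsilon>" if "\<epsilon> > 0" for m \<epsilon>
      by (rule density_forces_subspaces[OF insert.hyps(1,2) insert.IH that])
  qed (use insert.hyps in auto)
  show ?case using density_forces_line[OF insert.prems] by (simp add: Q_def)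
qed

theorem theorem1p1:
  fixes k :: nat and \<delta> :: real
  assumes "k \<ge> 1" and "\<delta> > 0"
  shows "\<exists>N0\<ge>1. \<forall>N\<ge>N0. \<forall>A. A \<subseteq> words k {1..N} \<and> real (card A) \<ge> \<delta> * real k ^ N
           \<longrightarrow> contains_combinatorial_line k N A"
proof -
  let ?S = "{1..k}"
  have "?S \<noteq> {}" using assms(1) by simp
  then obtain n where n: "\<And>J A. finite J \<Longrightarrow> n \<le> card J \<Longrightarrow> A \<subseteq> J \<rightarrow>\<^sub>E ?S \<Longrightarrow>
     \<delta> \<le> avg (J \<rightarrow>\<^sub>E ?S) (\<lambda>w. of_bool (w \<in> A)) \<Longrightarrow> has_subspace ?S 1 J A"
    using density_hales_jewett[of ?S \<delta>] assms(2) unfolding density_forces_subspace_def by blast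
  have "contains_combinatorial_line k N A"
    if N: "max 1 n \<le> N" and A: "A \<subseteq> words k {1..N}" and dense: "\<delta> * real k ^ N \<le> real (card A)" for N A
  proof -
    let ?J = "{1..N}"
    have A': "A \<subseteq> ?J \<rightarrow>\<^sub>E ?S" using A by (simp add: words_def)
    have "(\<Sum>w\<in>?J \<rightarrow>\<^sub>E ?S. of_bool (w \<in> A)) = real (card A)"
      using A' words_finite[of ?J ?S] by (simp add: Int_absorb1)
    then have avg_A: "avg (?J \<rightarrow>\<^sub>E ?S) (\<lambda>w. of_bool (w \<in> A)) = real (card A) / real k ^ N"
      by (simp add: avg_def card_PiE)
    have "\<delta> \<le> real (card A) / real k ^ N" using dense assms(1) by (simp add: field_simps)
    then have "\<delta> \<le> avg (?J \<rightarrow>\<^sub>E ?S) (\<lambda>w. of_bool (w \<in> A))" unfolding avg_A .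
    then have "has_subspace ?S 1 ?J A" using N A' by (intro n) auto
    then obtain \<tau> where \<tau>: "\<tau> \<in> patterns ?S {..<1} ?J" and line: "\<forall>x\<in>{..<1} \<rightarrow>\<^sub>E ?S. fill ?J \<tau> x \<in> A"
      unfolding has_subspace_def by blast
    define I where "I = {j \<in> ?J. \<tau> j = Inr 0}"
    define w0 where "w0 = (\<lambda>j\<in>?J - I. projl (\<tau> j))"
    have fixed: "\<exists>a\<in>?S. \<tau> j = Inl a" if "j \<in> ?J - I" for j
    proof -
      have "j \<in> ?J" using that by blast
      from pattern_word[OF \<tau>] this show ?thesis
        by (rule letter_or_variable) (use that in \<open>auto simp: I_def\<close>)
    qed
    obtain j0 where j0: "j0 \<in> I" using pattern_variable[OF \<tau>, of 0] by (auto simp: I_def)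
    have w0: "w0 \<in> words k (?J - I)"
      unfolding words_def w0_def restrict_PiE_iff using fixed by force
    have "combinatorial_line k N I w0 \<subseteq> A"
    proof
      fix w assume "w \<in> combinatorial_line k N I w0"
      then obtain c where w: "w \<in> ?J \<rightarrow>\<^sub>E ?S" and base: "restrict w (?J - I) = w0" and c: "\<forall>i\<in>I. w i = c"
        unfolding combinatorial_line_def words_def by blast
      have "c \<in> ?S" using PiE_mem[OF w, of j0] j0 c by (auto simp: I_def)
      then have "fill ?J \<tau> (\<lambda>i\<in>{..<1}. c) \<in> A" by (rule bspec[OF line constant_word_in])
      moreover have "fill ?J \<tau> (\<lambda>i\<in>{..<1}. c) = w"
      proof
        fix j
        consider "j \<notin> ?J" | "j \<in> I" | "j \<in> ?J - I" by blast
        then show "fill ?J \<tau> (\<lambda>i\<in>{..<1}. c) j = w j"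
        proof cases
          case 1
          then show ?thesis using PiE_arb[OF w 1] unfolding fill_def by (simp only: restrict_def if_False)
        next
          case 2
          then show ?thesis using c by (auto simp: fill_def I_def)
        next
          case 3
          then obtain a where "\<tau> j = Inl a" using fixed by blast
          then show ?thesis using fun_cong[OF base, of j] 3 by (simp add: fill_def w0_def)
        qed
      qed
      ultimately show "w \<in> A" by simp
    qed
    moreover have "I \<subseteq> ?J" by (auto simp: I_def)
    ultimately show ?thesis using j0 w0 unfolding contains_combinatorial_line_def by blast
  qed
  then show ?thesis by (intro exI[of _ "max 1 n"]) auto
qed

end
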